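(* If $P$ is an atomless poset satisfying Y-c.c., then $P$ adds an unbounded real, i.e.\ a function in $\omega^\omega$ not dominated modulo finite by any function in $\omega^\omega$ from the ground model.
   Context: For a separative poset $P$, $RO(P)$ is its completion; $H_\theta$ ($\theta$ large regular) is the set of sets of hereditary cardinality $<\theta$. $P$ satisfies \emph{Y-c.c.} if for every countable elementary submodel $M\prec H_\theta$ containing $P$ and every $q\in P$ there is a filter $F\in M$ on $RO(P)$ with $\{p\in RO(P)\cap M\colon p\geq q\}\subset F$ ($p\geq q$ means $q$ is stronger). *)

theory Defs
  imports Main "HOL-Library.Countable_Set"
begin

unbundle cardinal_syntax

section \<open>Sets of bounded hereditary cardinality\<close>

text \<open>
  The type \<open>'k hset\<close> consists of all sets that hereditarily have at most \<open>|UNIV :: 'k set|\<close>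
  elements: well-founded trees, where each node has no children or a family of children
  indexed by \<open>'k\<close> (repetitions allowed), up to bisimilarity.
\<close>

datatype 'k tree = Leaf | Node "'k \<Rightarrow> 'k tree"

primrec tree_eq :: "'k tree \<Rightarrow> 'k tree \<Rightarrow> bool" where
  "tree_eq Leaf = (\<lambda>t. t = Leaf)"
| "tree_eq (Node f) = (\<lambda>t. case t of Leaf \<Rightarrow> False | Node g \<Rightarrow>
     (\<forall>a. \<exists>b. tree_eq (f a) (g b)) \<and> (\<forall>b. \<exists>a. tree_eq (f a) (g b)))"

lemma tree_eq_refl: "tree_eq t t"
  by (induction t) auto

lemma tree_eq_sym: "tree_eq s t \<Longrightarrow> tree_eq t s"
proof (induction s arbitrary: t)
  case (Node f)
  have IH: "\<And>a x. tree_eq (f a) x \<Longrightarrow> tree_eq x (f a)"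
    using Node.IH by blast
  show ?case using Node.prems by (cases t) (auto, (meson IH)+)
qed auto

lemma tree_eq_trans: "tree_eq s t \<Longrightarrow> tree_eq t u \<Longrightarrow> tree_eq s u"
proof (induction s arbitrary: t u)
  case (Node f)
  have IH: "\<And>a x y. tree_eq (f a) x \<Longrightarrow> tree_eq x y \<Longrightarrow> tree_eq (f a) y"
    using Node.IH by blast
  show ?case using Node.prems by (cases t; cases u) (auto, (meson IH)+)
qed auto

quotient_type 'k hset = "'k tree" / tree_eq
  by (rule equivpI)
     (auto intro!: reflpI sympI transpI intro: tree_eq_refl tree_eq_sym tree_eq_trans)

definition elts :: "'k hset \<Rightarrow> 'k hset set" where
  "elts x = (case rep_hset x of Leaf \<Rightarrow> {} | Node f \<Rightarrow> range (\<lambda>a. abs_hset (f a)))"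

lemma tree_eq_rep_abs: "tree_eq (rep_hset (abs_hset t)) t"
  using Quotient3_rep_abs[OF Quotient3_hset] tree_eq_refl by blast

lemma elts_abs_Leaf: "elts (abs_hset Leaf :: 'k hset) = {}"
  using tree_eq_rep_abs[of "Leaf :: 'k tree"]
  by (cases "rep_hset (abs_hset (Leaf :: 'k tree))") (auto simp: elts_def)

lemma elts_abs_Node: "elts (abs_hset (Node f)) = range (\<lambda>a. abs_hset (f a))"
proof -
  obtain g where r: "rep_hset (abs_hset (Node f)) = Node g"
    using tree_eq_rep_abs[of "Node f"] by (cases "rep_hset (abs_hset (Node f))") auto
  have "tree_eq (Node g) (Node f)"
    using tree_eq_rep_abs[of "Node f"] r by simp
  then have "\<forall>b. \<exists>a. abs_hset (g b) = abs_hset (f a)" "\<forall>a. \<exists>b. abs_hset (g b) = abs_hset (f a)"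
    by (simp_all add: hset.abs_eq_iff)
  then show ?thesis
    unfolding elts_def r by (auto simp: image_iff) metis
qed

lemma abs_rep_hset: "abs_hset (rep_hset x) = x"
  by (rule Quotient3_abs_rep[OF Quotient3_hset])

lemma hset_cases: obtains "x = abs_hset Leaf" | f where "x = abs_hset (Node f)"
  by (metis abs_rep_hset tree.exhaust)

lemma elts_inject: "elts x = elts y \<longleftrightarrow> x = y"
proof
  assume eq: "elts x = elts y"
  have "tree_eq (Node f) (Node g)"
    if "range (\<lambda>a. abs_hset (f a)) = range (\<lambda>a. abs_hset (g a))" for f g :: "'a \<Rightarrow> 'a tree"
  proof -
    have "\<forall>a. \<exists>b. abs_hset (f a) = abs_hset (g b)" "\<forall>b. \<exists>a. abs_hset (f a) = abs_hset (g b)"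
      using that by (auto simp: set_eq_iff image_iff) metis
    then show ?thesis by (simp add: hset.abs_eq_iff)
  qed
  then show "x = y"
    using eq
    by (cases x rule: hset_cases; cases y rule: hset_cases)
       (auto simp only: elts_abs_Leaf elts_abs_Node hset.abs_eq_iff tree_eq_refl)
qed simp

definition mem_rel :: "('k hset \<times> 'k hset) set" where
  "mem_rel = {(x, y). x \<in> elts y}"

lemma wf_mem_rel: "wf mem_rel"
proof (rule wfUNIVI)
  fix Q :: "'k hset \<Rightarrow> bool" and x
  assume H: "\<forall>x. (\<forall>y. (y, x) \<in> mem_rel \<longrightarrow> Q y) \<longrightarrow> Q x"
  have "Q (abs_hset t)" for t :: "'k tree"
  proof (induction t)
    case Leaf
    show ?case using H by (auto simp: mem_rel_def elts_abs_Leaf)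
  next
    case (Node f)
    have "Q y" if "y \<in> elts (abs_hset (Node f))" for y
      using that Node by (auto simp: elts_abs_Node)
    then show ?case using H by (auto simp: mem_rel_def)
  qed
  then show "Q x" by (metis hset_cases)
qed

text \<open>\<open>hset_of X\<close> is only meaningful for \<open>|X| \<le>o |UNIV :: 'k set|\<close>.\<close>

definition hset_of :: "'k hset set \<Rightarrow> 'k hset" where
  "hset_of X = (THE x. elts x = X)"

lemma elts_hset_of:
  fixes X :: "'k hset set"
  assumes "|X| \<le>o |UNIV :: 'k set|"
  shows "elts (hset_of X) = X"
proof -
  have "\<exists>x. elts x = X"
  proof (cases "X = {}")
    case True
    then show ?thesis using elts_abs_Leaf by blast
  next
    case False
    then obtain h :: "'k \<Rightarrow> 'k hset" where h: "X = range h"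
      using assms card_of_ordLeq2[OF False, of "UNIV :: 'k set"] by blast
    have "elts (abs_hset (Node (\<lambda>k. rep_hset (h k)))) = X"
      by (simp add: elts_abs_Node abs_rep_hset h)
    then show ?thesis by blast
  qed
  then show ?thesis
    unfolding hset_of_def by (metis (mono_tags, lifting) elts_inject theI)
qed

definition opair :: "'k hset \<Rightarrow> 'k hset \<Rightarrow> 'k hset" where
  "opair x y = hset_of {hset_of {x}, hset_of {x, y}}"

definition trcl :: "'k hset \<Rightarrow> 'k hset set" where
  "trcl x = {y. (y, x) \<in> mem_rel\<^sup>+}"

text \<open>
  For a cardinal \<open>\<theta>\<close> given as a cardinal order on (a subset of) \<open>'k\<close>, the type \<open>'k hset\<close>
  is large enough to contain every set of hereditary cardinality less than \<open>\<theta>\<close>.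
\<close>

definition Hcard :: "'k rel \<Rightarrow> 'k hset set" where
  "Hcard \<theta> = {x. |trcl x| <o \<theta>}"


section \<open>First-order formulas of set theory and elementary submodels\<close>

datatype fm = FMem nat nat | FEq nat nat | FNeg fm | FAnd fm fm | FEx nat fm

primrec sat :: "'k hset set \<Rightarrow> fm \<Rightarrow> (nat \<Rightarrow> 'k hset) \<Rightarrow> bool" where
  "sat D (FMem i j) e \<longleftrightarrow> e i \<in> elts (e j)"
| "sat D (FEq i j) e \<longleftrightarrow> e i = e j"
| "sat D (FNeg \<phi>) e \<longleftrightarrow> \<not> sat D \<phi> e"
| "sat D (FAnd \<phi> \<psi>) e \<longleftrightarrow> sat D \<phi> e \<and> sat D \<psi> e"
| "sat D (FEx i \<phi>) e \<longleftrightarrow> (\<exists>x\<in>D. sat D \<phi> (e(i := x)))"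

definition elementary_submodel :: "'k hset set \<Rightarrow> 'k hset set \<Rightarrow> bool" where
  "elementary_submodel M N \<longleftrightarrow>
     M \<noteq> {} \<and> M \<subseteq> N \<and> (\<forall>\<phi> e. range e \<subseteq> M \<longrightarrow> (sat M \<phi> e \<longleftrightarrow> sat N \<phi> e))"

definition FOr :: "fm \<Rightarrow> fm \<Rightarrow> fm" where
  "FOr \<phi> \<psi> = FNeg (FAnd (FNeg \<phi>) (FNeg \<psi>))"

definition FImp :: "fm \<Rightarrow> fm \<Rightarrow> fm" where
  "FImp \<phi> \<psi> = FNeg (FAnd \<phi> (FNeg \<psi>))"

definition FAll :: "nat \<Rightarrow> fm \<Rightarrow> fm" where
  "FAll i \<phi> = FNeg (FEx i (FNeg \<phi>))"

definition FExIn :: "nat \<Rightarrow> nat \<Rightarrow> fm \<Rightarrow> fm" where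
  "FExIn i j \<phi> = FEx i (FAnd (FMem i j) \<phi>)"

definition FAllIn :: "nat \<Rightarrow> nat \<Rightarrow> fm \<Rightarrow> fm" where
  "FAllIn i j \<phi> = FAll i (FImp (FMem i j) \<phi>)"


section \<open>Posets and their completions\<close>

text \<open>A poset is a set of the form \<open>opair A R\<close>; \<open>ple P p q\<close> means that \<open>p\<close> is stronger than \<open>q\<close>.\<close>

definition pcarrier :: "'k hset \<Rightarrow> 'k hset set" where
  "pcarrier P = {p. \<exists>A R. P = opair A R \<and> p \<in> elts A}"

definition ple :: "'k hset \<Rightarrow> 'k hset \<Rightarrow> 'k hset \<Rightarrow> bool" where
  "ple P p q \<longleftrightarrow> (\<exists>A R. P = opair A R \<and> opair p q \<in> elts R)"

definition poset :: "'k hset \<Rightarrow> bool" where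
  "poset P \<longleftrightarrow>
     (\<exists>A R. P = opair A R \<and> (\<forall>z\<in>elts R. \<exists>p\<in>elts A. \<exists>q\<in>elts A. z = opair p q)) \<and>
     (\<forall>p\<in>pcarrier P. ple P p p) \<and>
     (\<forall>p q. ple P p q \<and> ple P q p \<longrightarrow> p = q) \<and>
     (\<forall>p q r. ple P p q \<and> ple P q r \<longrightarrow> ple P p r)"

definition compatible :: "'k hset \<Rightarrow> 'k hset \<Rightarrow> 'k hset \<Rightarrow> bool" where
  "compatible P p q \<longleftrightarrow> (\<exists>r\<in>pcarrier P. ple P r p \<and> ple P r q)"

definition separative :: "'k hset \<Rightarrow> bool" where
  "separative P \<longleftrightarrow>
     (\<forall>p\<in>pcarrier P. \<forall>q\<in>pcarrier P. \<not> ple P p q \<longrightarrow>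
        (\<exists>r\<in>pcarrier P. ple P r p \<and> \<not> compatible P r q))"

definition atomless :: "'k hset \<Rightarrow> bool" where
  "atomless P \<longleftrightarrow>
     (\<forall>p\<in>pcarrier P. \<exists>q\<in>pcarrier P. \<exists>r\<in>pcarrier P. ple P q p \<and> ple P r p \<and> \<not> compatible P q r)"

text \<open>
  The completion is the algebra of regular open sets in the topology on \<open>P\<close> whose open
  sets are the downward closed ones, ordered by inclusion.
\<close>

definition po_closure :: "'k hset \<Rightarrow> 'k hset set \<Rightarrow> 'k hset set" where
  "po_closure P U = {p \<in> pcarrier P. \<exists>q\<in>U. ple P q p}"

definition po_interior :: "'k hset \<Rightarrow> 'k hset set \<Rightarrow> 'k hset set" where
  "po_interior P U = {p \<in> pcarrier P. \<forall>q\<in>pcarrier P. ple P q p \<longrightarrow> q \<in> U}"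

definition RO :: "'k hset \<Rightarrow> 'k hset set" where
  "RO P = {u. elts u \<subseteq> pcarrier P \<and> po_interior P (po_closure P (elts u)) = elts u}"

text \<open>The canonical map of \<open>P\<close> into its completion.\<close>

definition ro_embed :: "'k hset \<Rightarrow> 'k hset \<Rightarrow> 'k hset" where
  "ro_embed P q = hset_of (po_interior P (po_closure P {p \<in> pcarrier P. ple P p q}))"

definition ro_filter :: "'k hset \<Rightarrow> 'k hset set \<Rightarrow> bool" where
  "ro_filter P F \<longleftrightarrow>
     F \<subseteq> RO P \<and> F \<noteq> {} \<and> hset_of {} \<notin> F \<and>
     (\<forall>u\<in>F. \<forall>v\<in>RO P. elts u \<subseteq> elts v \<longrightarrow> v \<in> F) \<and>
     (\<forall>u\<in>F. \<forall>v\<in>F. \<exists>w\<in>F. elts w \<subseteq> elts u \<and> elts w \<subseteq> elts v)"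

definition Ycc :: "'k rel \<Rightarrow> 'k hset \<Rightarrow> bool" where
  "Ycc \<theta> P \<longleftrightarrow>
     (\<forall>M. countable M \<and> elementary_submodel M (Hcard \<theta>) \<and> P \<in> M \<longrightarrow>
        (\<forall>q\<in>pcarrier P. \<exists>F\<in>M. ro_filter P (elts F) \<and>
           {p \<in> RO P \<inter> M. elts (ro_embed P q) \<subseteq> elts p} \<subseteq> elts F))"

text \<open>
  ``\<open>\<theta>\<close> is a large regular cardinal'': an uncountable regular cardinal such that \<open>Hcard \<theta>\<close>
  contains \<open>P\<close> and the power set of its completion.
\<close>

definition large_regular :: "'k rel \<Rightarrow> 'k hset \<Rightarrow> bool" where
  "large_regular \<theta> P \<longleftrightarrow>
     Card_order \<theta> \<and> regularCard \<theta> \<and> natLeq <o \<theta> \<and> P \<in> Hcard \<theta> \<and> |Pow (RO P)| <o \<theta>"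


section \<open>Names and the forcing relation\<close>

inductive is_name :: "'k hset \<Rightarrow> 'k hset \<Rightarrow> bool" for P where
  "(\<And>z. z \<in> elts \<tau> \<Longrightarrow> \<exists>\<sigma> p. z = opair \<sigma> p \<and> p \<in> pcarrier P \<and> is_name P \<sigma>) \<Longrightarrow> is_name P \<tau>"

text \<open>
  Forcing of equality is defined by recursion on the rank of the names; by
  well-foundedness of membership the least fixed point is the only one.
\<close>

inductive forces_eq :: "'k hset \<Rightarrow> 'k hset \<Rightarrow> 'k hset \<Rightarrow> 'k hset \<Rightarrow> bool" for P where
  "\<lbrakk>\<forall>\<pi> s. opair \<pi> s \<in> elts \<tau> \<longrightarrow> (\<forall>q. ple P q p \<and> ple P q s \<longrightarrow>
      (\<exists>r \<rho> t. ple P r q \<and> opair \<rho> t \<in> elts \<sigma> \<and> ple P r t \<and> forces_eq P r \<pi> \<rho>));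
    \<forall>\<rho> t. opair \<rho> t \<in> elts \<sigma> \<longrightarrow> (\<forall>q. ple P q p \<and> ple P q t \<longrightarrow>
      (\<exists>r \<pi> s. ple P r q \<and> opair \<pi> s \<in> elts \<tau> \<and> ple P r s \<and> forces_eq P r \<pi> \<rho>))\<rbrakk>
   \<Longrightarrow> forces_eq P p \<tau> \<sigma>"

definition forces_mem :: "'k hset \<Rightarrow> 'k hset \<Rightarrow> 'k hset \<Rightarrow> 'k hset \<Rightarrow> bool" where
  "forces_mem P p \<tau> \<sigma> \<longleftrightarrow>
     (\<forall>q. ple P q p \<longrightarrow>
        (\<exists>r \<rho> t. ple P r q \<and> opair \<rho> t \<in> elts \<sigma> \<and> ple P r t \<and> forces_eq P r \<tau> \<rho>))"

primrec forces :: "'k hset \<Rightarrow> fm \<Rightarrow> 'k hset \<Rightarrow> (nat \<Rightarrow> 'k hset) \<Rightarrow> bool" where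
  "forces P (FMem i j) p e \<longleftrightarrow> forces_mem P p (e i) (e j)"
| "forces P (FEq i j) p e \<longleftrightarrow> forces_eq P p (e i) (e j)"
| "forces P (FNeg \<phi>) p e \<longleftrightarrow> (\<forall>q. ple P q p \<longrightarrow> \<not> forces P \<phi> q e)"
| "forces P (FAnd \<phi> \<psi>) p e \<longleftrightarrow> forces P \<phi> p e \<and> forces P \<psi> p e"
| "forces P (FEx i \<phi>) p e \<longleftrightarrow>
     (\<forall>q. ple P q p \<longrightarrow> (\<exists>r. ple P r q \<and> (\<exists>\<tau>. is_name P \<tau> \<and> forces P \<phi> r (e(i := \<tau>)))))"

text \<open>
  The canonical name of a ground model set. All conditions, rather than a largest one,
  are used as second components, since \<open>P\<close> need not have a largest element.
\<close>

function check :: "'k hset \<Rightarrow> 'k hset \<Rightarrow> 'k hset" where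
  "check P x = hset_of (\<Union>y\<in>elts x. opair (check P y) ` pcarrier P)"
  by auto
termination
  by (relation "inv_image mem_rel snd") (simp_all add: wf_inv_image wf_mem_rel, simp add: mem_rel_def)

declare check.simps [simp del]


section \<open>Unbounded reals\<close>

primrec hnat :: "nat \<Rightarrow> 'k hset" where
  "hnat 0 = hset_of {}"
| "hnat (Suc n) = hset_of (insert (hnat n) (elts (hnat n)))"

definition hreal :: "(nat \<Rightarrow> nat) \<Rightarrow> 'k hset" where
  "hreal g = hset_of (range (\<lambda>n. opair (hnat n) (hnat (g n))))"

definition hOmega :: "'k hset" where
  "hOmega = hset_of (range hnat)"

definition hBaire :: "'k hset" where
  "hBaire = hset_of (range hreal)"

text \<open>
  Variable 0 stands for \<open>\<omega>\<close>. Bound variables are named explicitly (4 to 7 and 10 to 14), so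
  the arguments of the formulas below must avoid the variables bound in them; all uses do.
\<close>

definition upair_fm :: "nat \<Rightarrow> nat \<Rightarrow> nat \<Rightarrow> fm" where
  "upair_fm z x y =
     FAnd (FAll 10 (FImp (FMem 10 z) (FOr (FEq 10 x) (FEq 10 y)))) (FAnd (FMem x z) (FMem y z))"

definition opair_fm :: "nat \<Rightarrow> nat \<Rightarrow> nat \<Rightarrow> fm" where
  "opair_fm z x y =
     FEx 11 (FEx 12 (FAnd (upair_fm 11 x x) (FAnd (upair_fm 12 x y) (upair_fm z 11 12))))"

definition app_fm :: "nat \<Rightarrow> nat \<Rightarrow> nat \<Rightarrow> fm" where
  "app_fm f x y = FExIn 13 f (opair_fm 13 x y)"

text \<open>\<open>f\<close> is a function from \<open>\<omega>\<close> to \<open>\<omega>\<close>.\<close>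

definition real_fm :: "nat \<Rightarrow> fm" where
  "real_fm f =
     FAnd (FAllIn 14 f (FExIn 4 0 (FExIn 5 0 (opair_fm 14 4 5))))
         (FAllIn 4 0 (FExIn 5 0 (FAnd (app_fm f 4 5) (FAllIn 6 0 (FImp (app_fm f 4 6) (FEq 6 5))))))"

text \<open>\<open>f(n) \<le> g(n)\<close> for all but finitely many \<open>n\<close>.\<close>

definition dominated_fm :: "nat \<Rightarrow> nat \<Rightarrow> fm" where
  "dominated_fm f g =
     FExIn 4 0 (FAllIn 5 0 (FImp (FOr (FMem 4 5) (FEq 4 5))
       (FAllIn 6 0 (FAllIn 7 0 (FImp (FAnd (app_fm f 5 6) (app_fm g 5 7))
         (FOr (FMem 6 7) (FEq 6 7)))))))"

text \<open>Variable 1 stands for the set of ground model reals.\<close>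

definition unbounded_real_fm :: fm where
  "unbounded_real_fm = FEx 2 (FAnd (real_fm 2) (FAllIn 3 1 (FNeg (dominated_fm 2 3))))"

definition adds_unbounded_real :: "'k hset \<Rightarrow> bool" where
  "adds_unbounded_real P \<longleftrightarrow>
     (\<forall>p\<in>pcarrier P.
        forces P unbounded_real_fm p (\<lambda>i. if i = 0 then check P hOmega else check P hBaire))"

end

theory Submission
  imports Defs
begin

text \<open>
  Downward Loewenheim--Skolem gives countable elementary submodels \<open>M\<close> of \<open>Hcard \<theta>\<close> that are
  closed under any countably many prescribed operations, so nothing has to be defined inside \<open>M\<close>.

  Y-c.c. implies c.c.c.: in an uncountable antichain one finds an uncountable subset \<open>Y\<close> with an
  injection \<open>h\<close> into the power set of \<open>\<omega>\<close>. If \<open>q \<in> Y - M\<close>, the filter \<open>F \<in> M\<close> attached to \<open>q\<close>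
  decides, for each \<open>n\<close>, whether it contains the sum of all \<open>x \<in> Y\<close> with \<open>n \<in> h x\<close>; this recovers
  \<open>h q\<close>, hence \<open>q\<close>, from \<open>F\<close>, so \<open>q \<in> M\<close>.

  By c.c.c. and atomlessness every filter \<open>F\<close> on the completion omits all finite partial sums of
  some countable partition of unity. Let \<open>M\<close> be closed under the choice of these partial sums, and
  let the \<open>k\<close>-th value of the generic real be the index of the piece of the \<open>k\<close>-th such partition
  (over all filters in \<open>M\<close>) that meets the generic filter. If this real were dominated by a ground
  model function, some condition \<open>q\<close> would lie below a finite partial sum of each of the
  partitions, so the filter \<open>F \<in> M\<close> attached to \<open>q\<close> would contain a partial sum that it omits.
\<close>

section \<open>Countable elementary submodels\<close>

lemma card_of_elts: "|elts (x :: 'k hset)| \<le>o |UNIV :: 'k set|"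
  by (cases x rule: hset_cases) (simp_all add: elts_abs_Leaf elts_abs_Node card_of_empty card_of_image)

lemma mem_induct [case_names mem]:
  assumes "\<And>x. (\<And>y. y \<in> elts x \<Longrightarrow> Q y) \<Longrightarrow> Q x"
  shows "Q x"
  using wf_mem_rel by (rule wf_induct_rule) (use assms in \<open>auto simp: mem_rel_def\<close>)

text \<open>Countably many formulas give countably many Skolem functions, so closing a countable set
  under them keeps it countable.\<close>

instance fm :: countable
  by countable_datatype

text \<open>A crude strict bound on the indices in atomic subformulas, free or bound; it serves to
  show that only a finite initial part of an environment matters.\<close>

primrec fm_bound :: "fm \<Rightarrow> nat" where
  "fm_bound (FMem i j) = Suc (max i j)"
| "fm_bound (FEq i j) = Suc (max i j)"
| "fm_bound (FNeg \<phi>) = fm_bound \<phi>"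
| "fm_bound (FAnd \<phi> \<psi>) = max (fm_bound \<phi>) (fm_bound \<psi>)"
| "fm_bound (FEx i \<phi>) = fm_bound \<phi>"

lemma sat_cong: "(\<And>i. i < fm_bound \<phi> \<Longrightarrow> e i = e' i) \<Longrightarrow> sat D \<phi> e \<longleftrightarrow> sat D \<phi> e'"
proof (induction \<phi> arbitrary: e e')
  case (FNeg \<phi>)
  show ?case using FNeg.IH[of e e'] FNeg.prems by simp
next
  case (FAnd \<phi> \<psi>)
  show ?case using FAnd.IH[of e e'] FAnd.prems by simp
next
  case (FEx i \<phi>)
  have "sat D \<phi> (e(i := x)) \<longleftrightarrow> sat D \<phi> (e'(i := x))" for x
    by (rule FEx.IH) (use FEx.prems in simp)
  then show ?case by simp
qed (simp_all add: less_Suc_eq_le)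

text \<open>In the induction on formulas only the quantifier needs an argument: \<open>wit\<close>
  moves a witness from \<open>N\<close> into \<open>M\<close>.\<close>

lemma Tarski_Vaught:
  assumes "M \<noteq> {}" "M \<subseteq> N"
    and wit: "\<And>\<phi> i e. range e \<subseteq> M \<Longrightarrow> \<exists>x\<in>N. sat N \<phi> (e(i := x)) \<Longrightarrow> \<exists>x\<in>M. sat N \<phi> (e(i := x))"
  shows "elementary_submodel M N"
proof -
  have "sat M \<phi> e \<longleftrightarrow> sat N \<phi> e" if "range e \<subseteq> M" for \<phi> e
    using that
  proof (induction \<phi> arbitrary: e)
    case (FEx i \<phi>)
    have "sat M \<phi> (e(i := x)) \<longleftrightarrow> sat N \<phi> (e(i := x))" if "x \<in> M" for x
      by (rule FEx.IH) (use FEx.prems that in auto)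
    then show ?case using wit[OF FEx.prems, of \<phi> i] \<open>M \<subseteq> N\<close> by auto
  qed auto
  then show ?thesis using assms by (simp add: elementary_submodel_def)
qed

text \<open>Skolem hull: \<open>C\<close> is closed in \<omega> stages under Skolem functions for
  all formulas and under the maps \<open>f n\<close>. These maps are arbitrary, so \<open>M\<close>
  can later be closed under operations obtained by choice.\<close>

lemma countable_elementary_submodel:
  fixes N :: "'k hset set" and f :: "nat \<Rightarrow> 'k hset \<Rightarrow> 'k hset"
  assumes C: "countable C" "C \<subseteq> N" "C \<noteq> {}"
  obtains M where "countable M" "C \<subseteq> M" "elementary_submodel M N"
    "\<And>n x. x \<in> M \<Longrightarrow> f n x \<in> N \<Longrightarrow> f n x \<in> M"
proof -
  obtain d where d: "d \<in> C" using C by blast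
  \<comment> \<open>A finite list of parameters is read as an environment padded with
    \<open>d\<close>. For the lists used below the padding starts at \<open>fm_bound \<phi>\<close>,
    where it cannot influence satisfaction.\<close>
  define env where "env = (\<lambda>xs i. if i < length xs then xs ! i else d)"
  define sk where "sk = (\<lambda>\<phi> i xs. SOME x. x \<in> N \<and> sat N \<phi> ((env xs)(i := x)))"
  \<comment> \<open>Intersecting with \<open>N\<close> keeps every stage inside \<open>N\<close>,
    whatever \<open>sk\<close> returns when there is no witness.\<close>
  define G where "G = (\<lambda>S. S \<union> (\<Union>n. f n ` S \<inter> N) \<union> (\<Union>\<phi> i. sk \<phi> i ` lists S \<inter> N))"
  define S where "S = (\<lambda>n. (G ^^ n) C)"
  have S0: "S 0 = C" and SS: "S (Suc n) = G (S n)" for n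
    by (simp_all add: S_def)
  have "mono S"
    by (rule monoI, rule lift_Suc_mono_le[of S]) (auto simp: SS G_def)
  then have mono: "S m \<subseteq> S n" if "m \<le> n" for m n using that by (auto dest: monoD)
  have cS: "countable (S n)" for n
    by (induction n) (auto simp: S0 SS G_def C)
  have sS: "S n \<subseteq> N" for n
    by (induction n) (use C in \<open>auto simp: S0 SS G_def\<close>)
  define M where "M = (\<Union>n. S n)"
  \<comment> \<open>The stages increase, so finitely many parameters from the union occur together
    at one stage.\<close>
  have lists: "\<exists>n. xs \<in> lists (S n)" if "xs \<in> lists M" for xs
    using that
  proof (induction xs)
    case (Cons x xs)
    then obtain m n where "x \<in> S m" "xs \<in> lists (S n)" by (auto simp: M_def)
    then have "x # xs \<in> lists (S (max m n))"
      using mono[of m "max m n"] lists_mono[OF mono[of n "max m n"]] by auto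
    then show ?case by blast
  qed simp
  have "\<exists>x\<in>M. sat N \<phi> (e(i := x))"
    if e: "range e \<subseteq> M" and ex: "\<exists>x\<in>N. sat N \<phi> (e(i := x))" for \<phi> i e
  proof -
    define xs where "xs = map e [0..<fm_bound \<phi>]"
    have eq: "sat N \<phi> (e(i := x)) \<longleftrightarrow> sat N \<phi> ((env xs)(i := x))" for x
      by (rule sat_cong) (simp add: env_def xs_def)
    have "xs \<in> lists M" using e by (auto simp: xs_def image_subset_iff)
    then obtain n where n: "xs \<in> lists (S n)" using lists by blast
    have *: "sk \<phi> i xs \<in> N \<and> sat N \<phi> ((env xs)(i := sk \<phi> i xs))"
      unfolding sk_def by (rule someI_ex) (use ex eq in blast)
    then have "sk \<phi> i xs \<in> S (Suc n)" using n unfolding SS G_def by blast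
    then show ?thesis using * eq by (auto simp: M_def)
  qed
  then have "elementary_submodel M N"
    by (intro Tarski_Vaught) (use sS d S0 in \<open>auto simp: M_def subset_iff\<close>)
  moreover have "f n x \<in> M" if "x \<in> M" "f n x \<in> N" for n x
  proof -
    obtain m where "x \<in> S m" using \<open>x \<in> M\<close> by (auto simp: M_def)
    then have "f n x \<in> S (Suc m)" using that by (auto simp: SS G_def)
    then show ?thesis by (auto simp: M_def)
  qed
  moreover have "countable M" "C \<subseteq> M" using cS S0 by (auto simp: M_def)
  ultimately show thesis using that by blast
qed

section \<open>Regular open sets of conditions\<close>

lemma elts_hset_of_countable:
  fixes X :: "'k hset set"
  assumes "infinite (UNIV :: 'k set)" "countable X"
  shows "elts (hset_of X) = X"
proof (rule elts_hset_of)
  have "|X| \<le>o |UNIV :: nat set|"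
    using assms(2) by (auto simp: countable_def card_of_ordLeq[symmetric])
  also have "|UNIV :: nat set| \<le>o |UNIV :: 'k set|"
    using assms(1) infinite_iff_card_of_nat by blast
  finally show "|X| \<le>o |UNIV :: 'k set|" .
qed

lemma elts_opair:
  fixes x y :: "'k hset"
  assumes "infinite (UNIV :: 'k set)"
  shows "elts (opair x y) = {hset_of {x}, hset_of {x, y}}"
  using assms by (simp add: opair_def elts_hset_of_countable)

lemma opair_inject:
  fixes x y :: "'k hset"
  assumes "infinite (UNIV :: 'k set)"
  shows "opair x y = opair x' y' \<longleftrightarrow> x = x' \<and> y = y'"
proof
  note [simp] = elts_opair[OF assms] elts_hset_of_countable[OF assms]
  have [simp]: "hset_of A = hset_of B \<longleftrightarrow> A = B" if "countable A" "countable B" for A B :: "'k hset set"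
    using that by (metis elts_hset_of_countable[OF assms])
  assume "opair x y = opair x' y'"
  then have "{hset_of {x}, hset_of {x, y}} = {hset_of {x'}, hset_of {x', y'}}"
    by (metis elts_opair[OF assms])
  then show "x = x' \<and> y = y'"
    by (auto simp: doubleton_eq_iff)
qed simp

lemma mem_trcl: "y \<in> elts x \<Longrightarrow> y \<in> trcl x"
  by (auto simp: trcl_def mem_rel_def)

lemma trcl_trans: "y \<in> trcl x \<Longrightarrow> z \<in> trcl y \<Longrightarrow> z \<in> trcl x"
  by (auto simp: trcl_def)

lemma trcl_subset:
  assumes "elts x \<subseteq> trcl y"
  shows "trcl x \<subseteq> trcl y"
proof
  fix z assume "z \<in> trcl x"
  then have "(z, x) \<in> mem_rel\<^sup>+" by (simp add: trcl_def)
  then obtain w where "w \<in> elts x" "(z, w) \<in> mem_rel\<^sup>*"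
    by (auto simp: mem_rel_def dest: tranclD2)
  then show "z \<in> trcl y"
    using assms trcl_trans[of w y z] by (auto simp: trcl_def rtrancl_eq_or_trancl)
qed

text \<open>The infinite index type makes countable sets, hence numerals and Kuratowski pairs,
  faithfully representable in \<open>'k hset\<close>.\<close>

locale forcing_poset =
  fixes P :: "'k hset"
  assumes poset: "poset P" and inf: "infinite (UNIV :: 'k set)"
begin

abbreviation le :: "'k hset \<Rightarrow> 'k hset \<Rightarrow> bool" (infix "\<sqsubseteq>" 50) where
  "p \<sqsubseteq> q \<equiv> ple P p q"

abbreviation "Cond \<equiv> pcarrier P"

lemmas elts_countable [simp] = elts_hset_of_countable[OF inf]
lemmas opair_inject [simp] = opair_inject[OF inf]

text \<open>Injectivity of pairing makes the decomposition of \<open>P\<close> unique, which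
  eliminates the existential quantifiers in \<open>pcarrier\<close> and \<open>ple\<close>.\<close>

lemma poset_opair:
  "\<exists>A R. P = opair A R \<and> Cond = elts A \<and> (\<forall>p q. p \<sqsubseteq> q \<longleftrightarrow> opair p q \<in> elts R) \<and>
     (\<forall>z\<in>elts R. \<exists>p\<in>elts A. \<exists>q\<in>elts A. z = opair p q)"
proof -
  obtain A R where PAR: "P = opair A R" "\<forall>z\<in>elts R. \<exists>p\<in>elts A. \<exists>q\<in>elts A. z = opair p q"
    using poset unfolding poset_def by blast
  have "Cond = elts A" "p \<sqsubseteq> q \<longleftrightarrow> opair p q \<in> elts R" for p q
    by (simp_all add: PAR(1) pcarrier_def ple_def)
  then show ?thesis using PAR by blast
qed

lemma le_Cond: "p \<sqsubseteq> q \<Longrightarrow> p \<in> Cond" "p \<sqsubseteq> q \<Longrightarrow> q \<in> Cond"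
  using poset_opair by (metis opair_inject)+

lemma le_refl: "p \<in> Cond \<Longrightarrow> p \<sqsubseteq> p"
  and le_trans: "p \<sqsubseteq> q \<Longrightarrow> q \<sqsubseteq> r \<Longrightarrow> p \<sqsubseteq> r"
  using poset unfolding poset_def by blast+

lemma card_of_Cond: "|Cond| \<le>o |UNIV :: 'k set|"
  using poset_opair card_of_elts by metis

text \<open>If \<open>P\<close> is the pair of \<open>A\<close> and \<open>R\<close>, then
  \<open>A\<close> belongs to its singleton, which belongs to \<open>P\<close>. This controls the
  hereditary size of conditions and of elements of the completion.\<close>

lemma Cond_subset_trcl: "Cond \<subseteq> trcl P"
proof -
  obtain A R where *: "P = opair A R" "Cond = elts A"
    by (metis poset_opair)
  have "hset_of {A} \<in> elts P" "A \<in> elts (hset_of {A})"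
    by (auto simp: *(1) elts_opair[OF inf])
  then show ?thesis using *(2) trcl_trans mem_trcl by blast
qed

section \<open>Regularization, complements and suprema of sets of conditions\<close>

definition reg :: "'k hset set \<Rightarrow> 'k hset set" where
  "reg U = po_interior P (po_closure P U)"

text \<open>The interior of the closure unfolds to density below \<open>p\<close>. For down closed
  \<open>U\<close> this means that \<open>p\<close> forces the generic filter to meet
  \<open>U\<close>.\<close>

lemma mem_reg: "p \<in> reg U \<longleftrightarrow> p \<in> Cond \<and> (\<forall>q. q \<sqsubseteq> p \<longrightarrow> (\<exists>r\<in>U. r \<sqsubseteq> q))"
  by (auto simp: reg_def po_interior_def po_closure_def dest: le_Cond)

lemma reg_mono: "U \<subseteq> V \<Longrightarrow> reg U \<subseteq> reg V"
  by (auto simp: mem_reg) blast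

lemma reg_down: "p \<in> reg U \<Longrightarrow> q \<sqsubseteq> p \<Longrightarrow> q \<in> reg U"
  by (auto simp: mem_reg dest: le_Cond le_trans)

lemma reg_reg: "reg (reg U) = reg U"
proof (intro equalityI subsetI)
  fix p assume p: "p \<in> reg (reg U)"
  have "\<exists>s\<in>U. s \<sqsubseteq> q" if q: "q \<sqsubseteq> p" for q
  proof -
    obtain r where r: "r \<in> reg U" "r \<sqsubseteq> q"
      using p q unfolding mem_reg[of p] by blast
    then have "r \<sqsubseteq> r" using le_Cond le_refl by blast
    then obtain s where "s \<in> U" "s \<sqsubseteq> r" using r unfolding mem_reg by blast
    then show ?thesis using r le_trans by blast
  qed
  then show "p \<in> reg U" using p by (simp add: mem_reg)
next
  fix p assume p: "p \<in> reg U"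
  then show "p \<in> reg (reg U)"
    using reg_down[OF p] le_refl[OF le_Cond(1)] by (subst mem_reg) (auto simp: mem_reg[of p])
qed

definition down_closed :: "'k hset set \<Rightarrow> bool" where
  "down_closed U \<longleftrightarrow> U \<subseteq> Cond \<and> (\<forall>p\<in>U. \<forall>q. q \<sqsubseteq> p \<longrightarrow> q \<in> U)"

text \<open>For down closed \<open>U\<close>, these are the conditions incompatible with every
  member of \<open>U\<close>: the complement in the completion.\<close>

definition neg :: "'k hset set \<Rightarrow> 'k hset set" where
  "neg U = {p \<in> Cond. \<forall>q. q \<sqsubseteq> p \<longrightarrow> q \<notin> U}"

lemma down_closed_neg: "down_closed (neg U)"
  by (auto simp: down_closed_def neg_def dest: le_Cond le_trans)

lemma subset_reg: "down_closed U \<Longrightarrow> U \<subseteq> reg U"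
  unfolding down_closed_def subset_iff mem_reg by (metis le_refl)

lemma reg_neg: "down_closed U \<Longrightarrow> reg (neg U) = neg U"
  by (intro equalityI subset_reg down_closed_neg)
    (simp add: subset_iff mem_reg neg_def down_closed_def, metis le_refl)

text \<open>For down closed \<open>U\<close> this is the supremum of \<open>U\<close> in the
  completion, so hulls of unions play the role of Boolean sums.\<close>

definition hull :: "'k hset set \<Rightarrow> 'k hset" where
  "hull U = hset_of (reg U)"

lemma elts_subset_Cond: "X \<subseteq> Cond \<Longrightarrow> elts (hset_of X) = X"
  using card_of_Cond card_of_mono1 elts_hset_of ordLeq_transitive by blast

lemma elts_hull [simp]: "elts (hull U) = reg U"
  unfolding hull_def by (rule elts_subset_Cond) (auto simp: mem_reg)

lemma RO_iff: "u \<in> RO P \<longleftrightarrow> reg (elts u) = elts u"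
  by (auto simp: RO_def reg_def po_interior_def)

lemma hull_RO: "hull U \<in> RO P"
  by (simp add: RO_iff reg_reg)

lemma elts_ro_embed: "elts (ro_embed P q) = reg {p \<in> Cond. p \<sqsubseteq> q}"
  using elts_hull[of "{p \<in> Cond. p \<sqsubseteq> q}"] by (simp add: ro_embed_def hull_def reg_def)

text \<open>A regular open set containing \<open>q\<close> contains the whole cone below
  \<open>q\<close>. Hence Y-c.c. can be applied through the plain membership
  \<open>q \<in> elts u\<close>.\<close>

lemma ro_embed_subset:
  assumes "u \<in> RO P" "q \<in> elts u"
  shows "elts (ro_embed P q) \<subseteq> elts u"
proof -
  have "{p \<in> Cond. p \<sqsubseteq> q} \<subseteq> elts u"
    using assms reg_down[of q "elts u"] by (auto simp: RO_iff)
  then have "reg {p \<in> Cond. p \<sqsubseteq> q} \<subseteq> reg (elts u)"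
    by (rule reg_mono)
  then show ?thesis
    using assms(1) by (simp add: RO_iff elts_ro_embed)
qed

section \<open>Submodels and filters obtained from Y-c.c\<close>

lemma Hcard_mem: "P \<in> Hcard \<theta> \<Longrightarrow> elts x \<subseteq> trcl P \<Longrightarrow> x \<in> Hcard \<theta>"
  unfolding Hcard_def mem_Collect_eq by (metis trcl_subset card_of_mono1 ordLeq_ordLess_trans)

lemma RO_subset_Hcard: "P \<in> Hcard \<theta> \<Longrightarrow> RO P \<subseteq> Hcard \<theta>"
  using Hcard_mem Cond_subset_trcl by (auto simp: RO_def)

lemma Cond_subset_Hcard: 
  assumes "P \<in> Hcard \<theta>" shows "Cond \<subseteq> Hcard \<theta>"
proof
  fix p assume "p \<in> Cond"
  then have "elts p \<subseteq> trcl P" using Cond_subset_trcl by (auto intro: trcl_trans mem_trcl)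
  then show "p \<in> Hcard \<theta>" using assms by (simp add: Hcard_mem)
qed

text \<open>Combines the Skolem hull with Y-c.c. One model \<open>M\<close> serves all conditions
  \<open>q\<close>, while the filter depends on \<open>q\<close>; closure under \<open>f\<close> is
  granted for values in \<open>Hcard \<theta>\<close>.\<close>

lemma Ycc_obtain_model:
  fixes f :: "nat \<Rightarrow> 'k hset \<Rightarrow> 'k hset"
  assumes "Ycc \<theta> P" "P \<in> Hcard \<theta>" "countable B" "B \<subseteq> Hcard \<theta>"
  obtains M where "countable M" "B \<subseteq> M"
    "\<And>n x. x \<in> M \<Longrightarrow> f n x \<in> Hcard \<theta> \<Longrightarrow> f n x \<in> M"
    "\<And>q. q \<in> Cond \<Longrightarrow>
      \<exists>F\<in>M. ro_filter P (elts F) \<and> (\<forall>u\<in>RO P \<inter> M. q \<in> elts u \<longrightarrow> u \<in> elts F)"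
proof -
  have B: "countable (insert P B)" "insert P B \<subseteq> Hcard \<theta>" "insert P B \<noteq> {}"
    using assms by auto
  show thesis
  proof (rule countable_elementary_submodel[OF B, of f])
    fix M assume M: "countable M" "insert P B \<subseteq> M" "elementary_submodel M (Hcard \<theta>)"
      and cl: "\<And>n x. x \<in> M \<Longrightarrow> f n x \<in> Hcard \<theta> \<Longrightarrow> f n x \<in> M"
    have "\<exists>F\<in>M. ro_filter P (elts F) \<and> (\<forall>u\<in>RO P \<inter> M. q \<in> elts u \<longrightarrow> u \<in> elts F)"
      if "q \<in> Cond" for q
    proof -
      have "countable M \<and> elementary_submodel M (Hcard \<theta>) \<and> P \<in> M" using M by simp
      from assms(1)[unfolded Ycc_def, rule_format, OF this that] obtain F where "F \<in> M" "ro_filter P (elts F)"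
        "{p \<in> RO P \<inter> M. elts (ro_embed P q) \<subseteq> elts p} \<subseteq> elts F"
        by auto
      moreover have "u \<in> {p \<in> RO P \<inter> M. elts (ro_embed P q) \<subseteq> elts p}"
        if "u \<in> RO P \<inter> M" "q \<in> elts u" for u
        using that ro_embed_subset[of u q] by auto
      ultimately show ?thesis by (meson subsetD)
    qed
    then show thesis using that[of M, OF M(1) _ cl] M(2) by auto
  qed
qed

end

section \<open>Partitions omitted by filters\<close>

context forcing_poset
begin

section \<open>The countable chain condition\<close>

lemma compatible_iff: "compatible P p q \<longleftrightarrow> (\<exists>r. r \<sqsubseteq> p \<and> r \<sqsubseteq> q)"
  unfolding compatible_def using le_Cond by blast

definition antichain :: "'k hset set \<Rightarrow> bool" where
  "antichain X \<longleftrightarrow> X \<subseteq> Cond \<and> (\<forall>x\<in>X. \<forall>y\<in>X. compatible P x y \<longrightarrow> x = y)"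

lemma reg_neg_disjoint: "p \<in> reg U \<Longrightarrow> p \<notin> neg U"
  unfolding mem_reg neg_def using le_refl le_trans by blast

text \<open>A filter omits the zero element \<open>hset_of {}\<close>, so the lower bound
  \<open>w\<close> of two members inside the filter is a nonempty set of conditions.\<close>

lemma ro_filter_meet:
  assumes "ro_filter P F" "u \<in> F" "v \<in> F"
  shows "\<exists>p\<in>Cond. p \<in> elts u \<and> p \<in> elts v"
proof -
  obtain w where w: "w \<in> F" "elts w \<subseteq> elts u" "elts w \<subseteq> elts v"
    using assms unfolding ro_filter_def by blast
  have "w \<in> RO P" using assms(1) w(1) unfolding ro_filter_def by blast
  then have "elts w \<subseteq> Cond" by (simp add: RO_def)
  moreover have "elts w \<noteq> {}"
  proof
    assume "elts w = {}"
    then have "w = hset_of {}" by (simp flip: elts_inject)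
    then show False using assms(1) w(1) by (simp add: ro_filter_def)
  qed
  ultimately show ?thesis using w by blast
qed

lemma Ycc_countable_antichain:
  assumes "Ycc \<theta> P" "P \<in> Hcard \<theta>" and X: "antichain X"
  shows "countable X"
proof (rule ccontr)
  assume unc: "uncountable X"
  \<comment> \<open>Comparing cardinals with the continuum avoids any use of \<open>\<omega>\<^sub>1\<close>.\<close>
  have "\<exists>Y h. Y \<subseteq> X \<and> uncountable Y \<and> inj_on (h :: 'k hset \<Rightarrow> nat set) Y"
  proof (cases "|X| \<le>o |UNIV :: nat set set|")
    case True
    then obtain h :: "'k hset \<Rightarrow> nat set" where "inj_on h X"
      by (auto simp: card_of_ordLeq[symmetric])
    then show ?thesis using unc by blast
  next
    case False
    then have "|UNIV :: nat set set| \<le>o |X|"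
      by (metis card_of_Well_order ordLeq_total)
    then obtain g :: "nat set \<Rightarrow> 'k hset" where g: "inj g" "range g \<subseteq> X"
      by (auto simp: card_of_ordLeq[symmetric])
    have "uncountable (range g)"
    proof
      assume "countable (range g)"
      then have "countable (UNIV :: nat set set)" using g(1) countable_image_inj_eq by blast
      then have "range (from_nat_into (UNIV :: nat set set)) = Pow UNIV"
        using range_from_nat_into[of "UNIV :: nat set set"] by simp
      then show False using Cantors_theorem[of "UNIV :: nat set"] by blast
    qed
    moreover have "inj_on (inv g) (range g)" using g(1) by (simp add: inj_on_inv_into)
    ultimately show ?thesis using g(2) by blast
  qed
  then obtain Y and h :: "'k hset \<Rightarrow> nat set"
    where Y: "Y \<subseteq> X" "uncountable Y" "inj_on h Y" by blast
  have anti: "x = y" if "x \<in> Y" "y \<in> Y" "r \<sqsubseteq> x" "r \<sqsubseteq> y" for x y r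
    using X Y(1) that unfolding antichain_def compatible_iff by blast
  have YC: "Y \<subseteq> Cond" using X Y(1) by (auto simp: antichain_def)
  \<comment> \<open>The hull of \<open>V n\<close> is the sum of all members of \<open>Y\<close>
    whose label contains \<open>n\<close>. As \<open>Y\<close> is an antichain, each of its members
    lies in this sum or in the complement, according to its label.\<close>
  define V where "V = (\<lambda>n. {p. \<exists>x\<in>Y. n \<in> h x \<and> p \<sqsubseteq> x})"
  have V: "down_closed (V n)" for n
    unfolding down_closed_def V_def using le_Cond le_trans by blast
  have in_V: "x \<in> reg (V n)" if "x \<in> Y" "n \<in> h x" for x n
  proof -
    have "x \<in> V n" using that YC le_refl unfolding V_def by blast
    then show ?thesis using subset_reg V by blast
  qed
  have in_neg_V: "x \<in> neg (V n)" if "x \<in> Y" "n \<notin> h x" for x n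
    using that YC anti unfolding V_def neg_def by blast
  have V_iff: "x \<in> reg (V n) \<longleftrightarrow> n \<in> h x" if "x \<in> Y" for x n
    using in_V[OF that] in_neg_V[OF that] reg_neg_disjoint by blast
  \<comment> \<open>\<open>sel\<close> decodes a filter: it returns the member of \<open>Y\<close>
    whose label is the set of all \<open>n\<close> with \<open>hull (V n)\<close> in the filter, if
    there is one.\<close>
  define sel where "sel = (\<lambda>F. SOME x. x \<in> Y \<and> (\<forall>n. hull (V n) \<in> elts F \<longleftrightarrow> x \<in> reg (V n)))"
  \<comment> \<open>The complements are put into \<open>M\<close> as well, so that the filter
    attached to \<open>q\<close> contains one of the two hulls for every \<open>n\<close>.\<close>
  define B where "B = range (\<lambda>n. hull (V n)) \<union> range (\<lambda>n. hull (neg (V n)))"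
  have "countable B" "B \<subseteq> RO P" using hull_RO by (auto simp: B_def)
  then have B: "countable B" "B \<subseteq> Hcard \<theta>" using RO_subset_Hcard[OF assms(2)] by auto
  show False
  proof (rule Ycc_obtain_model[OF assms(1,2) B, of "\<lambda>_. sel"])
    fix M
    assume M: "countable M" "B \<subseteq> M"
      and cl: "\<And>n::nat. \<And>x. x \<in> M \<Longrightarrow> sel x \<in> Hcard \<theta> \<Longrightarrow> sel x \<in> M"
      and fil: "\<And>q. q \<in> Cond \<Longrightarrow>
        \<exists>F\<in>M. ro_filter P (elts F) \<and> (\<forall>u\<in>RO P \<inter> M. q \<in> elts u \<longrightarrow> u \<in> elts F)"
    obtain q where q: "q \<in> Y" "q \<notin> M" using M(1) Y(2) by (meson countable_subset subsetI)
    then obtain F where F: "F \<in> M" "ro_filter P (elts F)"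
      and qF: "\<And>u. u \<in> RO P \<Longrightarrow> u \<in> M \<Longrightarrow> q \<in> elts u \<Longrightarrow> u \<in> elts F"
      using fil YC by blast
    have BM: "hull (V n) \<in> M" "hull (neg (V n)) \<in> M" for n
      using M(2) by (auto simp: B_def)
    have trace: "hull (V n) \<in> elts F \<longleftrightarrow> q \<in> reg (V n)" for n
    proof
      assume *: "hull (V n) \<in> elts F"
      show "q \<in> reg (V n)"
      proof (rule ccontr)
        assume "q \<notin> reg (V n)"
        then have "q \<in> neg (V n)" using V_iff in_neg_V q(1) by blast
        then have "hull (neg (V n)) \<in> elts F"
          using qF[OF hull_RO BM(2)] reg_neg[OF V] by simp
        from ro_filter_meet[OF F(2) * this] show False
          using reg_neg_disjoint reg_neg[OF V] by auto
      qed
    next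
      assume "q \<in> reg (V n)"
      then show "hull (V n) \<in> elts F" using qF[OF hull_RO BM(1)] by simp
    qed
    have "sel F \<in> Y \<and> (\<forall>n. hull (V n) \<in> elts F \<longleftrightarrow> sel F \<in> reg (V n))"
      unfolding sel_def by (rule someI[of _ q]) (use q trace in blast)
    then have "sel F \<in> Y" "h (sel F) = h q"
      using trace V_iff q(1) by blast+
    then have "sel F = q" using Y(3) q(1) by (simp add: inj_on_def)
    moreover have "q \<in> Hcard \<theta>" using Cond_subset_Hcard[OF assms(2)] YC q(1) by blast
    ultimately show False using cl[OF F(1)] q(2) by simp
  qed
qed

text \<open>Dependent choice: split \<open>s n\<close> into two incompatible conditions, keep one as
  \<open>b n\<close> and continue with the other as \<open>s (Suc n)\<close>.\<close>

lemma atomless_descending: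
  assumes "atomless P" "p \<in> Cond"
  shows "\<exists>s b. s (0::nat) = p \<and> (\<forall>m n. m \<le> n \<longrightarrow> s n \<sqsubseteq> s m) \<and>
    (\<forall>n. b n \<sqsubseteq> s n \<and> \<not> compatible P (b n) (s (Suc n)))"
proof -
  have "\<exists>s. \<forall>n. (s n \<in> Cond \<and> (n = 0 \<longrightarrow> s n = p)) \<and>
    (s (Suc n) \<sqsubseteq> s n \<and> (\<exists>b. b \<sqsubseteq> s n \<and> \<not> compatible P b (s (Suc n))))"
  proof (rule dependent_nat_choice)
    show "\<exists>x. x \<in> Cond \<and> (0 = (0::nat) \<longrightarrow> x = p)" using assms by blast
  next
    fix x :: "'k hset" and n :: nat
    assume "x \<in> Cond \<and> (n = 0 \<longrightarrow> x = p)"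
    then obtain l r where "l \<sqsubseteq> x" "r \<sqsubseteq> x" "\<not> compatible P l r" "r \<in> Cond"
      using assms(1) unfolding atomless_def by blast
    then show "\<exists>y. (y \<in> Cond \<and> (Suc n = 0 \<longrightarrow> y = p)) \<and>
      y \<sqsubseteq> x \<and> (\<exists>b. b \<sqsubseteq> x \<and> \<not> compatible P b y)" by blast
  qed
  then obtain s where s: "\<And>n. s n \<in> Cond" "s 0 = p" "\<And>n. s (Suc n) \<sqsubseteq> s n"
    "\<And>n. \<exists>b. b \<sqsubseteq> s n \<and> \<not> compatible P b (s (Suc n))" by blast
  then obtain b where b: "\<And>n. b n \<sqsubseteq> s n \<and> \<not> compatible P (b n) (s (Suc n))" by metis
  have "s n \<sqsubseteq> s m" if "m \<le> n" for m n
    using that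
  proof (induction rule: dec_induct)
    case base show ?case using s(1) le_refl by blast
  next
    case (step k) then show ?case using s(3) le_trans by blast
  qed
  then show ?thesis using s b by blast
qed

text \<open>The hulls of the cones below the \<open>s n\<close> are pairwise distinct, since
  \<open>b m\<close> lies in the \<open>m\<close>-th one and in no later one. This later bounds the
  continuum by the power set of the completion.\<close>

lemma infinite_RO:
  assumes "atomless P" "p \<in> Cond"
  shows "infinite (RO P)"
proof -
  obtain s b where s: "\<And>m n. m \<le> n \<Longrightarrow> s n \<sqsubseteq> s m"
    "\<And>n::nat. b n \<sqsubseteq> s n" "\<And>n. \<not> compatible P (b n) (s (Suc n))"
    using atomless_descending[OF assms] by blast
  have "hull {r. r \<sqsubseteq> s m} \<noteq> hull {r. r \<sqsubseteq> s n}" if "m < n" for m n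
  proof
    assume eq: "hull {r. r \<sqsubseteq> s m} = hull {r. r \<sqsubseteq> s n}"
    have "b m \<in> Cond" "b m \<sqsubseteq> b m" using s(2)[of m] le_Cond le_refl by blast+
    have "down_closed {r. r \<sqsubseteq> s m}"
      unfolding down_closed_def using le_trans le_Cond by blast
    then have "b m \<in> reg {r. r \<sqsubseteq> s m}"
      using subset_reg s(2)[of m] by blast
    then have "b m \<in> reg {r. r \<sqsubseteq> s n}" using eq by (metis elts_hull)
    then obtain r where "r \<sqsubseteq> s n" "r \<sqsubseteq> b m"
      using \<open>b m \<sqsubseteq> b m\<close> by (auto simp: mem_reg)
    then show False using s(1)[of "Suc m" n] s(3)[of m] that le_trans
      by (auto simp: compatible_iff)
  qed
  then have "inj (\<lambda>n. hull {r. r \<sqsubseteq> s n})"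
    by (intro linorder_injI)
  then have "infinite (range (\<lambda>n. hull {r. r \<sqsubseteq> s n}))"
    by (rule range_inj_infinite)
  then show ?thesis using hull_RO by (meson finite_subset image_subsetI)
qed

text \<open>Zorn's lemma for antichains inside \<open>D\<close>. When \<open>D\<close> is dense,
  such an antichain is maximal among all antichains of conditions.\<close>

lemma maximal_antichain:
  obtains A where "A \<subseteq> D" "antichain A"
    "\<And>p. p \<in> D \<Longrightarrow> p \<in> Cond \<Longrightarrow> \<exists>a\<in>A. compatible P p a"
proof -
  define \<A> where "\<A> = {A. A \<subseteq> D \<and> antichain A}"
  have "\<Union>\<C> \<in> \<A>" if "subset.chain \<A> \<C>" for \<C>
  proof -
    have *: "\<C> \<subseteq> \<A>" "\<And>X Y. X \<in> \<C> \<Longrightarrow> Y \<in> \<C> \<Longrightarrow> X \<subseteq> Y \<or> Y \<subseteq> X"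
      using that by (auto simp: subset_chain_def)
    have "x = y" if "x \<in> X" "X \<in> \<C>" "y \<in> Y" "Y \<in> \<C>" "compatible P x y" for x y X Y
      using *(2)[of X Y] *(1) that unfolding \<A>_def antichain_def by blast
    then show ?thesis using *(1) unfolding \<A>_def antichain_def by blast
  qed
  then obtain A where A: "A \<in> \<A>" "\<And>X. X \<in> \<A> \<Longrightarrow> A \<subseteq> X \<Longrightarrow> X = A"
    using subset_Zorn'[of \<A>] by blast
  have "\<exists>a\<in>A. compatible P p a" if "p \<in> D" "p \<in> Cond" for p
  proof (rule ccontr)
    assume no: "\<not> (\<exists>a\<in>A. compatible P p a)"
    have "compatible P a p \<longleftrightarrow> compatible P p a" for a by (auto simp: compatible_iff)
    then have "insert p A \<in> \<A>"
      using A(1) that no unfolding \<A>_def antichain_def by blast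
    then have "p \<in> A" using A(2) by blast
    moreover have "compatible P p p" using that le_refl by (auto simp: compatible_iff)
    ultimately show False using no by blast
  qed
  then show thesis using that A(1) unfolding \<A>_def by blast
qed

text \<open>If some \<open>p\<close> lies in all members of \<open>F\<close>, a descending sequence
  below \<open>p\<close> yields the pieces. Otherwise the conditions excluded by some member of
  \<open>F\<close> are dense, and a maximal antichain of them, countable by \<open>ccc\<close>,
  yields the pieces. They may still overlap; \<open>disjointify\<close> repairs this.\<close>

lemma filter_omits_partition:
  assumes "separative P" "atomless P"
    and ccc: "\<And>X. antichain X \<Longrightarrow> countable X" and F: "ro_filter P F"
  shows "\<exists>U :: nat \<Rightarrow> 'k hset set. (\<forall>n. down_closed (U n)) \<and>
    (\<forall>p\<in>Cond. \<exists>q n. q \<sqsubseteq> p \<and> q \<in> U n) \<and> (\<forall>N. hull (\<Union>n\<le>N. U n) \<notin> F)"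
proof (cases "\<exists>p\<in>Cond. \<forall>u\<in>F. p \<in> elts u")
  case True
  then obtain p where p: "p \<in> Cond" "\<And>u. u \<in> F \<Longrightarrow> p \<in> elts u" by blast
  obtain s b where s: "s 0 = p" "\<And>m n. m \<le> n \<Longrightarrow> s n \<sqsubseteq> s m"
    "\<And>n::nat. b n \<sqsubseteq> s n" "\<And>n. \<not> compatible P (b n) (s (Suc n))"
    using atomless_descending[OF assms(2) p(1)] by blast
  \<comment> \<open>The conditions below every \<open>s m\<close> are added to each piece; by
    separativity any other condition has an extension incompatible with some \<open>s m\<close>, so
    the pieces are dense together.\<close>
  define U where "U = (\<lambda>n. {r \<in> Cond. \<not> compatible P r (s n)} \<union> {r. \<forall>m. r \<sqsubseteq> s m})"
  have "down_closed (U n)" for n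
    unfolding down_closed_def U_def compatible_iff using le_trans le_Cond by blast
  moreover have "\<exists>q n. q \<sqsubseteq> p \<and> q \<in> U n" if p: "p \<in> Cond" for p
  proof (cases "\<forall>m. p \<sqsubseteq> s m")
    case True
    then have "p \<in> U 0" by (simp add: U_def)
    then show ?thesis using p le_refl by blast
  next
    case False
    then obtain m where "\<not> p \<sqsubseteq> s m" by blast
    moreover have "s m \<in> Cond" using s(2)[of m m] le_Cond by blast
    ultimately obtain r where "r \<in> Cond" "r \<sqsubseteq> p" "\<not> compatible P r (s m)"
      using assms(1) p unfolding separative_def by blast
    then show ?thesis unfolding U_def by blast
  qed
  moreover have "hull (\<Union>n\<le>N. U n) \<notin> F" for N
  proof
    assume "hull (\<Union>n\<le>N. U n) \<in> F"
    then have "p \<in> reg (\<Union>n\<le>N. U n)" using p(2) by fastforce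
    \<comment> \<open>\<open>b N\<close> refutes the partial sum: each extension of it lies below
      \<open>s n\<close> for all \<open>n \<le> N\<close> but is incompatible with
      \<open>s (Suc N)\<close>, so it is in none of these pieces.\<close>
    moreover have "b N \<sqsubseteq> p" using s(1) s(2)[of 0 N] s(3)[of N] le_trans by auto
    ultimately obtain r n where r: "r \<sqsubseteq> b N" "n \<le> N" "r \<in> U n"
      unfolding mem_reg by blast
    have "r \<sqsubseteq> s n" using r s(2)[OF r(2)] s(3)[of N] le_trans by blast
    moreover have "r \<sqsubseteq> r" using r le_Cond le_refl by blast
    ultimately have "r \<sqsubseteq> s (Suc N)" using r(3) unfolding U_def compatible_iff by blast
    then show False using s(4)[of N] r(1) by (auto simp: compatible_iff)
  qed
  ultimately show ?thesis by blast
next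
  case False
  have FRO: "u \<in> RO P" if "u \<in> F" for u using F that by (auto simp: ro_filter_def)
  define D where "D = {p. \<exists>u\<in>F. p \<in> neg (elts u)}"
  \<comment> \<open>No condition lies in all members of \<open>F\<close>, and these are regular
    open, so every condition has an extension in the complement of one of them.\<close>
  have dense: "\<exists>q\<in>D. q \<sqsubseteq> p" if p: "p \<in> Cond" for p
  proof -
    obtain u where u: "u \<in> F" "p \<notin> elts u" using False p by blast
    then have "p \<notin> reg (elts u)" using FRO RO_iff by simp
    then obtain q where q: "q \<sqsubseteq> p" "\<And>r. r \<in> elts u \<Longrightarrow> \<not> r \<sqsubseteq> q"
      using p unfolding mem_reg by blast
    then have "q \<in> neg (elts u)" using le_Cond unfolding neg_def by blast
    then show ?thesis using u(1) q(1) unfolding D_def by blast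
  qed
  obtain A where A: "A \<subseteq> D" "antichain A"
    and max: "\<And>p. p \<in> D \<Longrightarrow> p \<in> Cond \<Longrightarrow> \<exists>a\<in>A. compatible P p a"
    using maximal_antichain by metis
  obtain u0 where "u0 \<in> F" using F by (auto simp: ro_filter_def)
  then obtain p0 where p0: "p0 \<in> Cond" using ro_filter_meet[OF F] by blast
  have AD: "\<exists>r a. r \<sqsubseteq> p \<and> a \<in> A \<and> r \<sqsubseteq> a" if p: "p \<in> Cond" for p
  proof -
    obtain q where q: "q \<in> D" "q \<sqsubseteq> p" using dense[OF p] by blast
    then obtain a where "a \<in> A" "compatible P q a" using max le_Cond by blast
    then show ?thesis using q le_trans by (auto simp: compatible_iff)
  qed
  then have "A \<noteq> {}" using p0 by blast
  define a where "a = from_nat_into A"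
  have aA: "a n \<in> A" for n unfolding a_def by (rule from_nat_into) fact
  have a_surj: "\<exists>n. a n = x" if "x \<in> A" for x
    unfolding a_def by (rule from_nat_into_surj[OF ccc[OF A(2)] that])
  define U where "U = (\<lambda>n. {p. p \<sqsubseteq> a n})"
  have "down_closed (U n)" for n
    unfolding down_closed_def U_def using le_trans le_Cond by blast
  moreover have "\<exists>q n. q \<sqsubseteq> p \<and> q \<in> U n" if "p \<in> Cond" for p
    using AD[OF that] a_surj unfolding U_def by blast
  moreover have "hull (\<Union>n\<le>N. U n) \<notin> F" for N
  proof
    assume J: "hull (\<Union>n\<le>N. U n) \<in> F"
    have "\<forall>n. \<exists>u\<in>F. a n \<in> neg (elts u)" using aA A(1) unfolding D_def by blast
    then obtain u where u: "\<And>n. u n \<in> F" "\<And>n. a n \<in> neg (elts (u n))" by metis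
    \<comment> \<open>Each piece \<open>U n\<close> is disjoint from the member \<open>u n\<close>
      of \<open>F\<close>. A common lower bound in \<open>F\<close> of finitely many of these is
      disjoint from the partial sum.\<close>
    have "\<exists>w\<in>F. \<forall>n\<le>N. elts w \<subseteq> elts (u n)"
    proof (induction N)
      case 0 show ?case using u(1)[of 0] by auto
    next
      case (Suc N)
      then obtain w where w: "w \<in> F" "\<forall>n\<le>N. elts w \<subseteq> elts (u n)" by blast
      have "\<exists>w'\<in>F. elts w' \<subseteq> elts w \<and> elts w' \<subseteq> elts (u (Suc N))"
        using F w(1) u(1)[of "Suc N"] unfolding ro_filter_def by blast
      then show ?case using w(2) by (metis le_Suc_eq order_trans)
    qed
    then obtain w where w: "w \<in> F" "\<And>n. n \<le> N \<Longrightarrow> elts w \<subseteq> elts (u n)" by blast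
    obtain p where p: "p \<in> Cond" "p \<in> elts w" "p \<in> reg (\<Union>n\<le>N. U n)"
      using ro_filter_meet[OF F w(1) J] by auto
    then obtain r n where r: "r \<sqsubseteq> p" "n \<le> N" "r \<sqsubseteq> a n"
      using le_refl[of p] unfolding mem_reg U_def by blast
    have "p \<in> reg (elts (u n))"
      using w(2)[OF r(2)] p(2) FRO[OF u(1)] by (auto simp: RO_iff)
    then have "r \<in> elts (u n)"
      using reg_down[OF _ r(1)] FRO[OF u(1)] by (auto simp: RO_iff)
    then show False using u(2)[of n] r(3) unfolding neg_def by blast
  qed
  ultimately show ?thesis by blast
qed

text \<open>A matrix codes a name for a real: conditions in \<open>a k n\<close> decide the
  \<open>k\<close>-th value to be \<open>n\<close>. The last clause says that no condition forces a
  bound \<open>g\<close> valid at every \<open>k\<close>; bounds modulo finite are handled in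
  \<open>not_forces_dominated_fm\<close>.\<close>

definition unbounded_matrix :: "(nat \<Rightarrow> nat \<Rightarrow> 'k hset set) \<Rightarrow> bool" where
  "unbounded_matrix a \<longleftrightarrow>
     (\<forall>k n. down_closed (a k n)) \<and> (\<forall>k m n. m \<noteq> n \<longrightarrow> a k m \<inter> a k n = {}) \<and>
     (\<forall>k. \<forall>p\<in>Cond. \<exists>q n. q \<sqsubseteq> p \<and> q \<in> a k n) \<and>
     (\<forall>p\<in>Cond. \<forall>g. \<exists>k. p \<notin> reg (\<Union>n\<le>g k. a k n))"

text \<open>Earlier pieces are subtracted through \<open>neg\<close>. Density survives: for the
  least \<open>n\<close> such that \<open>U n\<close> has a member below \<open>p\<close>, no
  extension of that member is in an earlier piece.\<close>

lemma disjointify: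
  assumes U: "\<And>n::nat. down_closed (U n)" "\<And>p. p \<in> Cond \<Longrightarrow> \<exists>q n. q \<sqsubseteq> p \<and> q \<in> U n"
  defines "V \<equiv> \<lambda>n. {p \<in> U n. \<forall>m<n. p \<in> neg (U m)}"
  shows "down_closed (V n)" "m \<noteq> n \<Longrightarrow> V m \<inter> V n = {}"
    "p \<in> Cond \<Longrightarrow> \<exists>q n. q \<sqsubseteq> p \<and> q \<in> V n"
proof -
  show "down_closed (V n)"
    using U(1) down_closed_neg unfolding V_def down_closed_def by blast
  have "V m \<inter> V n = {}" if "m < n" for m n
  proof -
    have "p \<notin> V n" if "p \<in> V m" for p
    proof
      assume "p \<in> V n"
      then have "p \<in> neg (U m)" "p \<in> U m" using \<open>m < n\<close> that by (auto simp: V_def)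
      then show False using le_refl unfolding neg_def by blast
    qed
    then show ?thesis by blast
  qed
  then show "m \<noteq> n \<Longrightarrow> V m \<inter> V n = {}" by (metis Int_commute linorder_neqE_nat)
  assume p: "p \<in> Cond"
  define n where "n = (LEAST n. \<exists>q. q \<sqsubseteq> p \<and> q \<in> U n)"
  have "\<exists>n q. q \<sqsubseteq> p \<and> q \<in> U n" using U(2)[OF p] by blast
  then have "\<exists>q. q \<sqsubseteq> p \<and> q \<in> U n" unfolding n_def by (rule LeastI_ex)
  then obtain q where q: "q \<sqsubseteq> p" "q \<in> U n" by blast
  have "q \<in> neg (U m)" if "m < n" for m
    using not_less_Least[OF that[unfolded n_def]] q(1) le_trans le_Cond unfolding neg_def by blast
  then show "\<exists>q n. q \<sqsubseteq> p \<and> q \<in> V n" using q by (auto simp: V_def)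
qed

lemma Ycc_unbounded_matrix:
  assumes "separative P" "atomless P" "Ycc \<theta> P" "P \<in> Hcard \<theta>" "Cond \<noteq> {}"
  shows "\<exists>a. unbounded_matrix a"
proof -
  have "\<forall>F. \<exists>U. ro_filter P F \<longrightarrow> (\<forall>n::nat. down_closed (U n)) \<and>
    (\<forall>p\<in>Cond. \<exists>q n. q \<sqsubseteq> p \<and> q \<in> U n) \<and> (\<forall>N. hull (\<Union>n\<le>N. U n) \<notin> F)"
    using filter_omits_partition[OF assms(1,2) Ycc_countable_antichain[OF assms(3,4)]] by blast
  then obtain U where U: "\<And>F. ro_filter P F \<Longrightarrow> (\<forall>n::nat. down_closed (U F n)) \<and>
    (\<forall>p\<in>Cond. \<exists>q n. q \<sqsubseteq> p \<and> q \<in> U F n) \<and> (\<forall>N. hull (\<Union>n\<le>N. U F n) \<notin> F)"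
    by metis
  \<comment> \<open>\<open>f N F\<close> is the \<open>N\<close>-th partial sum of the partition
    chosen for \<open>F\<close>. Closure of \<open>M\<close> under all \<open>f N\<close> puts these
    sums within reach of the filters from Y-c.c.\<close>
  define f where "f = (\<lambda>N F. hull (\<Union>n\<le>N. U (elts F) n))"
  have fH: "f N F \<in> Hcard \<theta>" for N F
    using hull_RO RO_subset_Hcard[OF assms(4)] by (auto simp: f_def)
  have "countable ({} :: 'k hset set)" "{} \<subseteq> Hcard \<theta>" by auto
  then show ?thesis
  proof (rule Ycc_obtain_model[OF assms(3,4), of _ f])
    fix M
    assume M: "countable M" and cl: "\<And>N F. F \<in> M \<Longrightarrow> f N F \<in> Hcard \<theta> \<Longrightarrow> f N F \<in> M"
      and fil: "\<And>q. q \<in> Cond \<Longrightarrow>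
        \<exists>F\<in>M. ro_filter P (elts F) \<and> (\<forall>u\<in>RO P \<inter> M. q \<in> elts u \<longrightarrow> u \<in> elts F)"
    define K where "K = {F \<in> M. ro_filter P (elts F)}"
    have "countable K" using M by (auto simp: K_def)
    have "K \<noteq> {}" using fil assms(5) by (auto simp: K_def)
    \<comment> \<open>Row \<open>k\<close> of the matrix comes from the partition omitted by the
      \<open>k\<close>-th filter in \<open>M\<close>; repetitions in the enumeration are
      harmless.\<close>
    define G where "G = from_nat_into K"
    have GK: "ro_filter P (elts (G k))" for k
      using from_nat_into[OF \<open>K \<noteq> {}\<close>] by (auto simp: G_def K_def)
    have G_surj: "\<exists>k. F = G k" if "F \<in> M" "ro_filter P (elts F)" for F
      using from_nat_into_surj[OF \<open>countable K\<close>, of F] that by (auto simp: G_def K_def)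
    define V where "V = (\<lambda>k n. {p \<in> U (elts (G k)) n. \<forall>m<n. p \<in> neg (U (elts (G k)) m)})"
    have "down_closed (V k n)" "m \<noteq> n \<Longrightarrow> V k m \<inter> V k n = {}"
      "p \<in> Cond \<Longrightarrow> \<exists>q n. q \<sqsubseteq> p \<and> q \<in> V k n" for k m n p
      using disjointify[of "U (elts (G k))"] U[OF GK[of k]] unfolding V_def by blast+
    moreover have "\<exists>k. p \<notin> reg (\<Union>n\<le>g k. V k n)" if p: "p \<in> Cond" for p g
    proof (rule ccontr)
      assume "\<not> (\<exists>k. p \<notin> reg (\<Union>n\<le>g k. V k n))"
      then have pV: "p \<in> reg (\<Union>n\<le>g k. V k n)" for k by blast
      obtain F where F: "F \<in> M" "ro_filter P (elts F)"
        "\<forall>u\<in>RO P \<inter> M. p \<in> elts u \<longrightarrow> u \<in> elts F"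
        using fil[OF p] by blast
      then obtain k where k: "F = G k" using G_surj by blast
      \<comment> \<open>Disjointification only shrinks pieces, so \<open>p\<close> also lies in the
        partial sum of the original partition, which belongs to \<open>M\<close>.\<close>
      have "(\<Union>n\<le>g k. V k n) \<subseteq> (\<Union>n\<le>g k. U (elts F) n)" by (auto simp: V_def k)
      then have "p \<in> elts (f (g k) F)" using pV[of k] reg_mono unfolding f_def elts_hull by blast
      moreover have "f (g k) F \<in> RO P \<inter> M"
        using cl[OF F(1) fH] hull_RO by (auto simp: f_def)
      ultimately have "f (g k) F \<in> elts F" using F(3) by blast
      then show False using U[OF F(2)] by (simp add: f_def)
    qed
    ultimately have "unbounded_matrix V" unfolding unbounded_matrix_def by blast
    then show ?thesis by blast
  qed
qed

end

section \<open>The forcing relation\<close>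

context forcing_poset
begin

section \<open>Forced equality and membership of names\<close>

lemma fst_trcl:
  fixes \<pi> s \<tau> :: "'k hset"
  assumes "opair \<pi> s \<in> elts \<tau>"
  shows "\<pi> \<in> trcl \<tau>"
proof -
  have "hset_of {\<pi>} \<in> elts (opair \<pi> s)" "\<pi> \<in> elts (hset_of {\<pi>})"
    by (auto simp: elts_opair[OF inf])
  then show ?thesis using assms by (meson mem_trcl trcl_trans)
qed

text \<open>A name occurring in \<open>\<tau>\<close> is reached through the layers of a Kuratowski
  pair, so induction on names follows the transitive closure of membership.\<close>

lemma trcl_induct [case_names trcl]:
  assumes "\<And>x. (\<And>y. y \<in> trcl x \<Longrightarrow> Q y) \<Longrightarrow> Q x"
  shows "Q x"
  using wf_trancl[OF wf_mem_rel] by (rule wf_induct_rule) (use assms in \<open>auto simp: trcl_def\<close>)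

lemma forces_eqI:
  assumes "\<And>\<pi> s q. opair \<pi> s \<in> elts \<tau> \<Longrightarrow> q \<sqsubseteq> p \<Longrightarrow> q \<sqsubseteq> s \<Longrightarrow>
      \<exists>r \<rho> t. r \<sqsubseteq> q \<and> opair \<rho> t \<in> elts \<sigma> \<and> r \<sqsubseteq> t \<and> forces_eq P r \<pi> \<rho>"
    and "\<And>\<rho> t q. opair \<rho> t \<in> elts \<sigma> \<Longrightarrow> q \<sqsubseteq> p \<Longrightarrow> q \<sqsubseteq> t \<Longrightarrow>
      \<exists>r \<pi> s. r \<sqsubseteq> q \<and> opair \<pi> s \<in> elts \<tau> \<and> r \<sqsubseteq> s \<and> forces_eq P r \<pi> \<rho>"
  shows "forces_eq P p \<tau> \<sigma>"
  by (rule forces_eq.intros) (use assms in blast)+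

lemma forces_eqD1:
  "forces_eq P p \<tau> \<sigma> \<Longrightarrow> opair \<pi> s \<in> elts \<tau> \<Longrightarrow> q \<sqsubseteq> p \<Longrightarrow> q \<sqsubseteq> s \<Longrightarrow>
    \<exists>r \<rho> t. r \<sqsubseteq> q \<and> opair \<rho> t \<in> elts \<sigma> \<and> r \<sqsubseteq> t \<and> forces_eq P r \<pi> \<rho>"
  by (erule forces_eq.cases) blast

lemma forces_eqD2:
  "forces_eq P p \<tau> \<sigma> \<Longrightarrow> opair \<rho> t \<in> elts \<sigma> \<Longrightarrow> q \<sqsubseteq> p \<Longrightarrow> q \<sqsubseteq> t \<Longrightarrow>
    \<exists>r \<pi> s. r \<sqsubseteq> q \<and> opair \<pi> s \<in> elts \<tau> \<and> r \<sqsubseteq> s \<and> forces_eq P r \<pi> \<rho>"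
  by (erule forces_eq.cases) blast

lemma forces_eq_mono: "forces_eq P p \<tau> \<sigma> \<Longrightarrow> q \<sqsubseteq> p \<Longrightarrow> forces_eq P q \<tau> \<sigma>"
  by (rule forces_eqI) (meson forces_eqD1 forces_eqD2 le_trans)+

lemma forces_eq_refl: "forces_eq P p \<tau> \<tau>"
proof (induction \<tau> arbitrary: p rule: trcl_induct)
  case (trcl \<tau>)
  have "\<exists>r \<rho> t. r \<sqsubseteq> q \<and> opair \<rho> t \<in> elts \<tau> \<and> r \<sqsubseteq> t \<and> forces_eq P r \<pi> \<rho>"
    "\<exists>r \<rho> t. r \<sqsubseteq> q \<and> opair \<rho> t \<in> elts \<tau> \<and> r \<sqsubseteq> t \<and> forces_eq P r \<rho> \<pi>"
    if "opair \<pi> s \<in> elts \<tau>" "q \<sqsubseteq> p" "q \<sqsubseteq> s" for \<pi> s q p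
    using that trcl[OF fst_trcl[OF that(1)], of q] le_refl[OF le_Cond(1)[OF that(2)]] by blast+
  then show ?case by (intro forces_eqI)
qed

lemma forces_eq_sym: "forces_eq P p \<tau> \<sigma> \<Longrightarrow> forces_eq P p \<sigma> \<tau>"
proof (induction rule: forces_eq.induct)
  case (1 \<tau> p \<sigma>)
  show ?case by (rule forces_eqI) (use 1 in blast)+
qed

text \<open>Witnesses are followed through the middle name \<open>\<sigma>\<close>, strengthening
  the condition twice; monotonicity carries the equality obtained first to the final
  condition.\<close>

lemma forces_eq_trans: "forces_eq P p \<tau> \<sigma> \<Longrightarrow> forces_eq P p \<sigma> \<upsilon> \<Longrightarrow> forces_eq P p \<tau> \<upsilon>"
proof (induction \<tau> arbitrary: p \<sigma> \<upsilon> rule: trcl_induct)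
  case (trcl \<tau>)
  show ?case
  proof (rule forces_eqI)
    fix \<pi> s q assume *: "opair \<pi> s \<in> elts \<tau>" "q \<sqsubseteq> p" "q \<sqsubseteq> s"
    obtain r \<rho> t where r: "r \<sqsubseteq> q" "opair \<rho> t \<in> elts \<sigma>" "r \<sqsubseteq> t" "forces_eq P r \<pi> \<rho>"
      using forces_eqD1[OF trcl(2) *] by blast
    have "r \<sqsubseteq> p" using r * le_trans by blast
    then obtain r' \<chi> u where r': "r' \<sqsubseteq> r" "opair \<chi> u \<in> elts \<upsilon>" "r' \<sqsubseteq> u" "forces_eq P r' \<rho> \<chi>"
      using forces_eqD1[OF trcl(3) r(2) _ r(3)] by blast
    have "forces_eq P r' \<pi> \<chi>"
      using trcl(1)[OF fst_trcl[OF *(1)] forces_eq_mono[OF r(4) r'(1)] r'(4)] .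
    then show "\<exists>r \<rho> t. r \<sqsubseteq> q \<and> opair \<rho> t \<in> elts \<upsilon> \<and> r \<sqsubseteq> t \<and> forces_eq P r \<pi> \<rho>"
      using r(1) r' le_trans by blast
  next
    fix \<chi> u q assume *: "opair \<chi> u \<in> elts \<upsilon>" "q \<sqsubseteq> p" "q \<sqsubseteq> u"
    obtain r \<rho> t where r: "r \<sqsubseteq> q" "opair \<rho> t \<in> elts \<sigma>" "r \<sqsubseteq> t" "forces_eq P r \<rho> \<chi>"
      using forces_eqD2[OF trcl(3) *] by blast
    have "r \<sqsubseteq> p" using r * le_trans by blast
    then obtain r' \<pi> s where r': "r' \<sqsubseteq> r" "opair \<pi> s \<in> elts \<tau>" "r' \<sqsubseteq> s" "forces_eq P r' \<pi> \<rho>"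
      using forces_eqD2[OF trcl(2) r(2) _ r(3)] by blast
    have "forces_eq P r' \<pi> \<chi>"
      using trcl(1)[OF fst_trcl[OF r'(2)] r'(4) forces_eq_mono[OF r(4) r'(1)]] .
    then show "\<exists>r \<pi> s. r \<sqsubseteq> q \<and> opair \<pi> s \<in> elts \<tau> \<and> r \<sqsubseteq> s \<and> forces_eq P r \<pi> \<chi>"
      using r(1) r' le_trans by blast
  qed
qed

lemma forces_eq_dense:
  assumes "\<And>q. q \<sqsubseteq> p \<Longrightarrow> \<exists>r. r \<sqsubseteq> q \<and> forces_eq P r \<tau> \<sigma>"
  shows "forces_eq P p \<tau> \<sigma>"
proof (rule forces_eqI)
  fix \<pi> s q assume *: "opair \<pi> s \<in> elts \<tau>" "q \<sqsubseteq> p" "q \<sqsubseteq> s"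
  obtain r where r: "r \<sqsubseteq> q" "forces_eq P r \<tau> \<sigma>" using assms[OF *(2)] by blast
  have "r \<sqsubseteq> r" "r \<sqsubseteq> s" using r * le_trans le_refl le_Cond by blast+
  then show "\<exists>r \<rho> t. r \<sqsubseteq> q \<and> opair \<rho> t \<in> elts \<sigma> \<and> r \<sqsubseteq> t \<and> forces_eq P r \<pi> \<rho>"
    using forces_eqD1[OF r(2) *(1)] r(1) le_trans by blast
next
  fix \<rho> t q assume *: "opair \<rho> t \<in> elts \<sigma>" "q \<sqsubseteq> p" "q \<sqsubseteq> t"
  obtain r where r: "r \<sqsubseteq> q" "forces_eq P r \<tau> \<sigma>" using assms[OF *(2)] by blast
  have "r \<sqsubseteq> r" "r \<sqsubseteq> t" using r * le_trans le_refl le_Cond by blast+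
  then show "\<exists>r \<pi> s. r \<sqsubseteq> q \<and> opair \<pi> s \<in> elts \<tau> \<and> r \<sqsubseteq> s \<and> forces_eq P r \<pi> \<rho>"
    using forces_eqD2[OF r(2) *(1)] r(1) le_trans by blast
qed

lemma forces_mem_mono: "forces_mem P p \<tau> \<sigma> \<Longrightarrow> q \<sqsubseteq> p \<Longrightarrow> forces_mem P q \<tau> \<sigma>"
  unfolding forces_mem_def using le_trans by blast

lemma forces_mem_dense:
  assumes "\<And>q. q \<sqsubseteq> p \<Longrightarrow> \<exists>r. r \<sqsubseteq> q \<and> forces_mem P r \<tau> \<sigma>"
  shows "forces_mem P p \<tau> \<sigma>"
  unfolding forces_mem_def
proof (intro allI impI)
  fix q assume "q \<sqsubseteq> p"
  then obtain r where r: "r \<sqsubseteq> q" "forces_mem P r \<tau> \<sigma>" using assms by blast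
  have "r \<sqsubseteq> r" using r le_refl le_Cond by blast
  then obtain r' \<rho> t where "r' \<sqsubseteq> r" "opair \<rho> t \<in> elts \<sigma>" "r' \<sqsubseteq> t" "forces_eq P r' \<tau> \<rho>"
    using r(2) unfolding forces_mem_def by blast
  then show "\<exists>r \<rho> t. r \<sqsubseteq> q \<and> opair \<rho> t \<in> elts \<sigma> \<and> r \<sqsubseteq> t \<and> forces_eq P r \<tau> \<rho>"
    using r(1) le_trans by blast
qed

lemma forces_mem_cong:
  assumes "forces_mem P p \<tau> \<sigma>" "forces_eq P p \<tau> \<tau>'" "forces_eq P p \<sigma> \<sigma>'"
  shows "forces_mem P p \<tau>' \<sigma>'"
  unfolding forces_mem_def
proof (intro allI impI)
  fix q assume q: "q \<sqsubseteq> p"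
  obtain r \<rho> t where r: "r \<sqsubseteq> q" "opair \<rho> t \<in> elts \<sigma>" "r \<sqsubseteq> t" "forces_eq P r \<tau> \<rho>"
    using assms(1) q unfolding forces_mem_def by blast
  have rp: "r \<sqsubseteq> p" using r q le_trans by blast
  obtain r' \<chi> u where r': "r' \<sqsubseteq> r" "opair \<chi> u \<in> elts \<sigma>'" "r' \<sqsubseteq> u" "forces_eq P r' \<rho> \<chi>"
    using forces_eqD1[OF assms(3) r(2) rp r(3)] by blast
  have "forces_eq P r \<tau>' \<rho>"
    using forces_eq_trans[OF forces_eq_sym[OF forces_eq_mono[OF assms(2) rp]] r(4)] .
  then have "forces_eq P r' \<tau>' \<chi>" using forces_eq_trans forces_eq_mono r' by blast
  then show "\<exists>r \<rho> t. r \<sqsubseteq> q \<and> opair \<rho> t \<in> elts \<sigma>' \<and> r \<sqsubseteq> t \<and> forces_eq P r \<tau>' \<rho>"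
    using r(1) r' le_trans by blast
qed

section \<open>Monotonicity, density and substitution for forced formulas\<close>

lemma forces_mono: "forces P \<phi> p e \<Longrightarrow> q \<sqsubseteq> p \<Longrightarrow> forces P \<phi> q e"
proof (induction \<phi> arbitrary: p q e)
  case (FNeg \<phi>)
  show ?case using FNeg.prems le_trans unfolding forces.simps by blast
next
  case (FEx i \<phi>)
  show ?case using FEx.prems le_trans unfolding forces.simps by blast
next
  case (FAnd \<phi> \<psi>)
  show ?case using FAnd.prems FAnd.IH unfolding forces.simps by blast
qed (auto intro: forces_eq_mono forces_mem_mono)

text \<open>Together with \<open>forces_mono\<close> this says that the conditions forcing a formula
  form a regular open set. It is what cancels double negations later.\<close>

lemma forces_dense:
  "(\<And>q. q \<sqsubseteq> p \<Longrightarrow> \<exists>r. r \<sqsubseteq> q \<and> forces P \<phi> r e) \<Longrightarrow> forces P \<phi> p e"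
proof (induction \<phi> arbitrary: p e)
  case (FMem i j)
  show ?case unfolding forces.simps
    by (rule forces_mem_dense) (use FMem in simp)
next
  case (FEq i j)
  show ?case unfolding forces.simps
    by (rule forces_eq_dense) (use FEq in simp)
next
  case (FNeg \<phi>)
  show ?case unfolding forces.simps
  proof (intro allI impI notI)
    fix q assume q: "q \<sqsubseteq> p" "forces P \<phi> q e"
    then obtain r where r: "r \<sqsubseteq> q" "forces P (FNeg \<phi>) r e" using FNeg.prems by blast
    have "r \<sqsubseteq> r" using r le_refl le_Cond by blast
    then show False using r forces_mono[OF q(2) r(1)] by simp
  qed
next
  case (FAnd \<phi> \<psi>)
  show ?case using FAnd.IH[of p e] FAnd.prems by (meson forces.simps(4))
next
  case (FEx i \<phi>)
  show ?case unfolding forces.simps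
  proof (intro allI impI)
    fix q assume q: "q \<sqsubseteq> p"
    then obtain r where r: "r \<sqsubseteq> q" "forces P (FEx i \<phi>) r e" using FEx.prems by blast
    have "r \<sqsubseteq> r" using r le_refl le_Cond by blast
    then obtain r' \<tau> where "r' \<sqsubseteq> r" "is_name P \<tau>" "forces P \<phi> r' (e(i := \<tau>))"
      using r(2) unfolding forces.simps by blast
    then show "\<exists>r. r \<sqsubseteq> q \<and> (\<exists>\<tau>. is_name P \<tau> \<and> forces P \<phi> r (e(i := \<tau>)))"
      using r(1) le_trans by blast
  qed
qed

text \<open>In the induction, negation needs symmetry of forced equality to return from
  \<open>e'\<close> to \<open>e\<close>, and the quantifier needs reflexivity at the bound
  variable.\<close>

lemma forces_subst:
  "forces P \<phi> p e \<Longrightarrow> (\<And>i. forces_eq P p (e i) (e' i)) \<Longrightarrow> forces P \<phi> p e'"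
proof (induction \<phi> arbitrary: p e e')
  case (FMem i j)
  then show ?case by (auto intro: forces_mem_cong)
next
  case (FEq i j)
  then show ?case by simp (meson forces_eq_sym forces_eq_trans)
next
  case (FNeg \<phi>)
  have "\<not> forces P \<phi> q e'" if "q \<sqsubseteq> p" for q
    using FNeg.prems(1) FNeg.IH[of q e' e] that FNeg.prems(2) forces_eq_sym forces_eq_mono
    unfolding forces.simps by blast
  then show ?case by simp
next
  case (FAnd \<phi> \<psi>)
  then show ?case unfolding forces.simps by blast
next
  case (FEx i \<phi>)
  have "forces P \<phi> r (e'(i := \<tau>))" if "r \<sqsubseteq> p" "forces P \<phi> r (e(i := \<tau>))" for r \<tau>
    by (rule FEx.IH[OF that(2)])
      (use forces_eq_mono[OF FEx.prems(2) that(1)] forces_eq_refl in auto)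
  then show ?case using FEx.prems(1) le_trans unfolding forces.simps by meson
qed

lemma forces_subst_upd:
  assumes "forces P \<phi> p (e(i := \<tau>))" "forces_eq P p \<tau> \<sigma>"
  shows "forces P \<phi> p (e(i := \<sigma>))"
  using assms(1) by (rule forces_subst) (simp add: assms(2) forces_eq_refl)

section \<open>Derived connectives and bounded quantifiers\<close>

lemma forces_FImp: "forces P (FImp \<phi> \<psi>) p e \<longleftrightarrow> (\<forall>q. q \<sqsubseteq> p \<longrightarrow> forces P \<phi> q e \<longrightarrow> forces P \<psi> q e)"
proof
  assume L: "forces P (FImp \<phi> \<psi>) p e"
  show "\<forall>q. q \<sqsubseteq> p \<longrightarrow> forces P \<phi> q e \<longrightarrow> forces P \<psi> q e"
  proof (intro allI impI)
    fix q assume q: "q \<sqsubseteq> p" "forces P \<phi> q e"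
    show "forces P \<psi> q e"
    proof (rule forces_dense)
      fix r assume r: "r \<sqsubseteq> q"
      then have "forces P \<phi> r e" "r \<sqsubseteq> p" using q forces_mono le_trans by blast+
      then show "\<exists>s. s \<sqsubseteq> r \<and> forces P \<psi> s e"
        using L unfolding FImp_def forces.simps by blast
    qed
  qed
next
  assume "\<forall>q. q \<sqsubseteq> p \<longrightarrow> forces P \<phi> q e \<longrightarrow> forces P \<psi> q e"
  then show "forces P (FImp \<phi> \<psi>) p e"
    unfolding FImp_def forces.simps using le_refl le_Cond by blast
qed

lemma forces_FOr:
  "forces P (FOr \<phi> \<psi>) p e \<longleftrightarrow> (\<forall>q. q \<sqsubseteq> p \<longrightarrow> (\<exists>r. r \<sqsubseteq> q \<and> (forces P \<phi> r e \<or> forces P \<psi> r e)))"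
  unfolding FOr_def forces.simps by blast

lemma forces_FAll: "forces P (FAll i \<phi>) p e \<longleftrightarrow> (\<forall>\<tau>. is_name P \<tau> \<longrightarrow> forces P \<phi> p (e(i := \<tau>)))"
proof
  assume L: "forces P (FAll i \<phi>) p e"
  show "\<forall>\<tau>. is_name P \<tau> \<longrightarrow> forces P \<phi> p (e(i := \<tau>))"
  proof (intro allI impI, rule forces_dense)
    fix \<tau> q assume \<tau>: "is_name P \<tau>" and "q \<sqsubseteq> p"
    then obtain q' where q': "q' \<sqsubseteq> q"
      "\<And>r. r \<sqsubseteq> q' \<Longrightarrow> \<not> (\<forall>s. s \<sqsubseteq> r \<longrightarrow> \<not> forces P \<phi> s (e(i := \<tau>)))"
      using L unfolding FAll_def forces.simps by blast
    have "q' \<sqsubseteq> q'" using q'(1) le_refl le_Cond by blast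
    then show "\<exists>r. r \<sqsubseteq> q \<and> forces P \<phi> r (e(i := \<tau>))"
      using q' le_trans by blast
  qed
next
  assume R: "\<forall>\<tau>. is_name P \<tau> \<longrightarrow> forces P \<phi> p (e(i := \<tau>))"
  show "forces P (FAll i \<phi>) p e"
    unfolding FAll_def forces.simps
  proof (intro allI impI notI)
    fix q assume q: "q \<sqsubseteq> p"
      and *: "\<forall>q'. q' \<sqsubseteq> q \<longrightarrow> (\<exists>r. r \<sqsubseteq> q' \<and> (\<exists>\<tau>. is_name P \<tau> \<and>
        (\<forall>s. s \<sqsubseteq> r \<longrightarrow> \<not> forces P \<phi> s (e(i := \<tau>)))))"
    have "q \<sqsubseteq> q" using q le_refl le_Cond by blast
    then obtain r \<tau> where r: "r \<sqsubseteq> q" "is_name P \<tau>" "\<And>s. s \<sqsubseteq> r \<Longrightarrow> \<not> forces P \<phi> s (e(i := \<tau>))"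
      using * by blast
    have "r \<sqsubseteq> p" "r \<sqsubseteq> r" using r q le_trans le_refl le_Cond by blast+
    then show False using R r forces_mono by blast
  qed
qed

lemma is_nameD: "is_name P \<tau> \<Longrightarrow> opair \<rho> t \<in> elts \<tau> \<Longrightarrow> is_name P \<rho> \<and> t \<in> Cond"
  by (erule is_name.cases) (metis opair_inject)

lemma forces_memI: 
  assumes "opair \<rho> t \<in> elts \<sigma>" "q \<sqsubseteq> t"
  shows "forces_mem P q \<rho> \<sigma>"
  unfolding forces_mem_def using assms forces_eq_refl le_trans le_refl le_Cond by meson

text \<open>Below a stronger condition, a forced member of \<open>e j\<close> is forced equal to a
  first component listed in \<open>e j\<close>, and \<open>forces_subst_upd\<close> transfers the
  formula. The assumption \<open>i \<noteq> j\<close> keeps the bounding name fixed under the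
  update.\<close>

lemma forces_FAllIn:
  assumes "i \<noteq> j" "is_name P (e j)"
  shows "forces P (FAllIn i j \<phi>) p e \<longleftrightarrow>
    (\<forall>\<rho> t q. opair \<rho> t \<in> elts (e j) \<longrightarrow> q \<sqsubseteq> p \<longrightarrow> q \<sqsubseteq> t \<longrightarrow> forces P \<phi> q (e(i := \<rho>)))"
    (is "?L \<longleftrightarrow> ?R")
proof -
  have L: "?L \<longleftrightarrow> (\<forall>\<tau>. is_name P \<tau> \<longrightarrow>
      (\<forall>q. q \<sqsubseteq> p \<longrightarrow> forces_mem P q \<tau> (e j) \<longrightarrow> forces P \<phi> q (e(i := \<tau>))))"
    using assms(1) by (simp add: FAllIn_def forces_FAll forces_FImp)
  show ?thesis
  proof
    assume ?L
    then show ?R unfolding L using is_nameD[OF assms(2)] forces_memI by blast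
  next
    assume R: ?R
    have "forces P \<phi> q (e(i := \<tau>))" if q: "q \<sqsubseteq> p" "forces_mem P q \<tau> (e j)" for q \<tau>
    proof (rule forces_dense)
      fix q' assume q': "q' \<sqsubseteq> q"
      then obtain r \<rho> t where r: "r \<sqsubseteq> q'" "opair \<rho> t \<in> elts (e j)" "r \<sqsubseteq> t" "forces_eq P r \<tau> \<rho>"
        using q(2) unfolding forces_mem_def by blast
      have "r \<sqsubseteq> p" using r(1) q' q(1) le_trans by blast
      then have "forces P \<phi> r (e(i := \<rho>))" using R r by blast
      then have "forces P \<phi> r (e(i := \<tau>))" using forces_subst_upd forces_eq_sym r(4) by blast
      then show "\<exists>r. r \<sqsubseteq> q' \<and> forces P \<phi> r (e(i := \<tau>))" using r(1) by blast
    qed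
    then show ?L unfolding L by blast
  qed
qed

lemma forces_FExIn:
  assumes "i \<noteq> j" "is_name P (e j)"
  shows "forces P (FExIn i j \<phi>) p e \<longleftrightarrow>
    (\<forall>q. q \<sqsubseteq> p \<longrightarrow> (\<exists>r \<rho> t. r \<sqsubseteq> q \<and> opair \<rho> t \<in> elts (e j) \<and> r \<sqsubseteq> t \<and> forces P \<phi> r (e(i := \<rho>))))"
    (is "?L \<longleftrightarrow> ?R")
proof -
  have L: "?L \<longleftrightarrow> (\<forall>q. q \<sqsubseteq> p \<longrightarrow> (\<exists>r. r \<sqsubseteq> q \<and> (\<exists>\<tau>. is_name P \<tau> \<and>
      forces_mem P r \<tau> (e j) \<and> forces P \<phi> r (e(i := \<tau>)))))"
    using assms(1) by (simp add: FExIn_def)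
  show ?thesis
  proof
    assume l: ?L
    show ?R
    proof (intro allI impI)
      fix q assume "q \<sqsubseteq> p"
      then obtain r \<tau> where r: "r \<sqsubseteq> q" "forces_mem P r \<tau> (e j)" "forces P \<phi> r (e(i := \<tau>))"
        using l unfolding L by blast
      have "r \<sqsubseteq> r" using r le_refl le_Cond by blast
      then obtain r' \<rho> t where r': "r' \<sqsubseteq> r" "opair \<rho> t \<in> elts (e j)" "r' \<sqsubseteq> t" "forces_eq P r' \<tau> \<rho>"
        using r(2) unfolding forces_mem_def by blast
      then have "forces P \<phi> r' (e(i := \<rho>))"
        using forces_subst_upd[OF forces_mono[OF r(3)]] by blast
      then show "\<exists>r \<rho> t. r \<sqsubseteq> q \<and> opair \<rho> t \<in> elts (e j) \<and> r \<sqsubseteq> t \<and> forces P \<phi> r (e(i := \<rho>))"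
        using r r' le_trans by blast
    qed
  next
    assume ?R
    then show ?L unfolding L using is_nameD[OF assms(2)] forces_memI by meson
  qed
qed

end

section \<open>The unbounded real\<close>

lemma hnat_elts:
  assumes "infinite (UNIV :: 'k set)"
  shows "elts (hnat n :: 'k hset) = hnat ` {..<n}"
proof (induction n)
  case (Suc n)
  have "elts (hnat (Suc n) :: 'k hset) = insert (hnat n) (hnat ` {..<n})"
    using Suc by (simp add: elts_hset_of_countable[OF assms])
  then show ?case by (simp add: lessThan_Suc)
qed (simp add: elts_hset_of_countable[OF assms])

lemma hnat_eq_iff:
  assumes "infinite (UNIV :: 'k set)"
  shows "(hnat m :: 'k hset) = hnat n \<longleftrightarrow> m = n"
proof -
  have "(hnat m :: 'k hset) \<noteq> hnat n" if "m < n" for m n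
  proof
    assume eq: "(hnat m :: 'k hset) = hnat n"
    have "(hnat m :: 'k hset) \<in> elts (hnat n)" using that by (auto simp: hnat_elts[OF assms])
    then have "(hnat m, hnat m :: 'k hset) \<in> mem_rel" by (simp add: mem_rel_def eq)
    then show False using wf_not_refl[OF wf_mem_rel] by blast
  qed
  then show ?thesis by (metis linorder_neqE_nat)
qed

lemma hnat_mem_iff:
  assumes "infinite (UNIV :: 'k set)"
  shows "(hnat m :: 'k hset) \<in> elts (hnat n) \<longleftrightarrow> m < n"
  by (auto simp: hnat_elts[OF assms] hnat_eq_iff[OF assms])

context forcing_poset
begin

lemmas hnat_eq [simp] = hnat_eq_iff[OF inf]
lemmas hnat_mem [simp] = hnat_mem_iff[OF inf]

lemma elts_hOmega: "elts (hOmega :: 'k hset) = range hnat"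
  by (simp add: hOmega_def)

lemma elts_hreal: "elts (hreal g :: 'k hset) = range (\<lambda>n. opair (hnat n) (hnat (g n)))"
  by (simp add: hreal_def)

text \<open>A size bound for the names built below: a union of at most \<open>|UNIV|\<close> images
  of sets of conditions is small enough for \<open>hset_of\<close>.\<close>

lemma elts_UNION:
  fixes f :: "'i \<Rightarrow> 'k hset \<Rightarrow> 'k hset"
  assumes "|I| \<le>o |UNIV :: 'k set|" "\<And>i. i \<in> I \<Longrightarrow> A i \<subseteq> Cond"
  shows "elts (hset_of (\<Union>i\<in>I. f i ` A i)) = (\<Union>i\<in>I. f i ` A i)"
proof (rule elts_hset_of, rule card_of_UNION_ordLeq_infinite[OF inf assms(1)], rule ballI)
  fix i assume "i \<in> I"
  then show "|f i ` A i| \<le>o |UNIV :: 'k set|"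
    using card_of_image card_of_mono1[OF assms(2)] card_of_Cond ordLeq_transitive by meson
qed

section \<open>Check names and absoluteness of bounded quantifiers\<close>

lemma elts_check: "elts (check P x) = (\<Union>y\<in>elts x. opair (check P y) ` Cond)"
  by (subst check.simps, rule elts_UNION) (auto simp: card_of_elts)

lemma opair_in_check: "opair \<rho> t \<in> elts (check P x) \<longleftrightarrow> t \<in> Cond \<and> (\<exists>y\<in>elts x. \<rho> = check P y)"
  by (auto simp: elts_check)

lemma is_name_check: "is_name P (check P x)"
proof (induction x rule: mem_induct)
  case (mem x)
  then show ?case by (intro is_name.intros) (auto simp: elts_check)
qed

text \<open>Membership induction on \<open>x\<close>, with \<open>p\<close> and \<open>y\<close>
  arbitrary because the witnesses of forced equality come with a stronger condition.\<close>

lemma forces_eq_check: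
  assumes "p \<in> Cond"
  shows "forces_eq P p (check P x) (check P y) \<longleftrightarrow> x = y"
proof
  show "forces_eq P p (check P x) (check P y) \<Longrightarrow> x = y"
    using assms
  proof (induction x arbitrary: y p rule: mem_induct)
    case (mem x)
    have "z \<in> elts y" if "z \<in> elts x" for z
    proof -
      have "opair (check P z) p \<in> elts (check P x)"
        using that mem(3) by (auto simp: opair_in_check)
      from forces_eqD1[OF mem(2) this le_refl le_refl] obtain r z'
        where "r \<sqsubseteq> p" "z' \<in> elts y" "forces_eq P r (check P z) (check P z')"
        using mem(3) by (auto simp: opair_in_check)
      then show ?thesis using mem(1)[OF that] le_Cond by blast
    qed
    moreover have "z \<in> elts x" if "z \<in> elts y" for z
    proof -
      have "opair (check P z) p \<in> elts (check P y)"
        using that mem(3) by (auto simp: opair_in_check)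
      from forces_eqD2[OF mem(2) this le_refl le_refl] obtain r z'
        where "r \<sqsubseteq> p" "z' \<in> elts x" "forces_eq P r (check P z') (check P z)"
        using mem(3) by (auto simp: opair_in_check)
      then show ?thesis using mem(1)[of z' r z] le_Cond by blast
    qed
    ultimately show ?case using elts_inject by blast
  qed
qed (simp add: forces_eq_refl)

text \<open>The existence of a condition matters: over an empty carrier every check name is
  empty.\<close>

lemma check_inject: "p \<in> Cond \<Longrightarrow> check P x = check P y \<longleftrightarrow> x = y"
  using forces_eq_check forces_eq_refl by metis

lemma forces_mem_check:
  assumes "p \<in> Cond"
  shows "forces_mem P p (check P x) (check P y) \<longleftrightarrow> x \<in> elts y"
proof
  assume "forces_mem P p (check P x) (check P y)"
  then obtain r z where "r \<sqsubseteq> p" "z \<in> elts y" "forces_eq P r (check P x) (check P z)"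
    using le_refl[OF assms] unfolding forces_mem_def opair_in_check by blast
  then show "x \<in> elts y" using forces_eq_check[of r x z] le_Cond(1)[of r p] by simp
next
  assume "x \<in> elts y"
  then show "forces_mem P p (check P x) (check P y)"
    using assms le_refl by (intro forces_memI[of _ p]) (auto simp: opair_in_check)
qed

text \<open>The components of a check name are check names of ground model elements, each paired
  with every condition, so the side condition on \<open>t\<close> disappears.\<close>

lemma forces_FAllIn_check:
  assumes "e j = check P x" "i \<noteq> j" "p \<in> Cond"
  shows "forces P (FAllIn i j \<phi>) p e \<longleftrightarrow> (\<forall>y\<in>elts x. forces P \<phi> p (e(i := check P y)))"
proof -
  have "is_name P (e j)" using assms is_name_check by simp
  show ?thesis
    unfolding forces_FAllIn[of i j e, OF assms(2) \<open>is_name P (e j)\<close>] unfolding assms(1) opair_in_check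
    using assms(3) le_refl le_Cond forces_mono by metis
qed

lemma forces_FExIn_check:
  assumes "e j = check P x" "i \<noteq> j"
  shows "forces P (FExIn i j \<phi>) p e \<longleftrightarrow>
    (\<forall>q. q \<sqsubseteq> p \<longrightarrow> (\<exists>r. r \<sqsubseteq> q \<and> (\<exists>y\<in>elts x. forces P \<phi> r (e(i := check P y)))))"
proof -
  have "is_name P (e j)" using assms is_name_check by simp
  show ?thesis
    unfolding forces_FExIn[of i j e, OF assms(2) \<open>is_name P (e j)\<close>] unfolding assms(1) opair_in_check
    using le_refl le_Cond by metis
qed

lemma forces_FExIn_checkI:
  assumes "e j = check P x" "i \<noteq> j" "y \<in> elts x" "forces P \<phi> p (e(i := check P y))"
  shows "forces P (FExIn i j \<phi>) p e"
  unfolding forces_FExIn_check[of e j, OF assms(1,2)]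
  using assms(3,4) forces_mono le_refl le_Cond by blast

text \<open>A forced disjunction asks only that densely many conditions force a disjunct. With truth
  values constant below \<open>p\<close> this collapses to an ordinary disjunction.\<close>

lemma forces_FOr_decided:
  assumes "p \<in> Cond" "\<And>q. q \<sqsubseteq> p \<Longrightarrow> forces P \<phi> q e \<longleftrightarrow> A" "\<And>q. q \<sqsubseteq> p \<Longrightarrow> forces P \<psi> q e \<longleftrightarrow> B"
  shows "forces P (FOr \<phi> \<psi>) p e \<longleftrightarrow> A \<or> B"
  unfolding forces_FOr
proof
  assume "\<forall>q. q \<sqsubseteq> p \<longrightarrow> (\<exists>r. r \<sqsubseteq> q \<and> (forces P \<phi> r e \<or> forces P \<psi> r e))"
  then obtain r where "r \<sqsubseteq> p" "forces P \<phi> r e \<or> forces P \<psi> r e"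
    using le_refl[OF assms(1)] by blast
  then show "A \<or> B" using assms(2,3) by blast
next
  assume AB: "A \<or> B"
  show "\<forall>q. q \<sqsubseteq> p \<longrightarrow> (\<exists>r. r \<sqsubseteq> q \<and> (forces P \<phi> r e \<or> forces P \<psi> r e))"
  proof (intro allI impI)
    fix q assume "q \<sqsubseteq> p"
    then have "q \<sqsubseteq> q" "forces P \<phi> q e \<or> forces P \<psi> q e"
      using assms(2,3)[of q] AB le_refl le_Cond by auto
    then show "\<exists>r. r \<sqsubseteq> q \<and> (forces P \<phi> r e \<or> forces P \<psi> r e)" by blast
  qed
qed

section \<open>Forcing of statements about pairs and function values\<close>

lemma forces_upair_fm:
  assumes "p \<in> Cond" "e z = check P c" "e x = check P a" "e y = check P b"
    "z \<noteq> 10" "x \<noteq> 10" "y \<noteq> 10"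
  shows "forces P (upair_fm z x y) p e \<longleftrightarrow> elts c = {a, b}"
proof -
  have "forces P (FAllIn 10 z (FOr (FEq 10 x) (FEq 10 y))) p e \<longleftrightarrow> (\<forall>w\<in>elts c. w = a \<or> w = b)"
    unfolding forces_FAllIn_check[of e z c, OF assms(2) assms(5)[symmetric] assms(1)]
    by (intro ball_cong refl forces_FOr_decided assms(1))
      (use assms le_Cond in \<open>auto simp: forces_eq_check\<close>)
  moreover have "forces P (FMem x z) p e \<longleftrightarrow> a \<in> elts c" "forces P (FMem y z) p e \<longleftrightarrow> b \<in> elts c"
    using assms by (simp_all add: forces_mem_check)
  ultimately show ?thesis
    unfolding upair_fm_def FAllIn_def[symmetric] forces.simps(4) by blast
qed

text \<open>The quantifiers over 11 and 12 range over all names. Their witnesses are forced to be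
  members of \<open>check P c\<close>, hence are forced equal to check names below a stronger
  condition, where \<open>up\<close> applies.\<close>

lemma forces_opair_fm:
  assumes "p \<in> Cond" "e z = check P c" "e x = check P a" "e y = check P b"
    "{x, y, z} \<inter> {10, 11, 12} = {}"
  shows "forces P (opair_fm z x y) p e \<longleftrightarrow> c = opair a b"
proof -
  let ?e = "\<lambda>d d'. e(11 := check P d, 12 := check P d')"
  have up: "forces P (upair_fm 11 x x) q (?e d d') \<longleftrightarrow> elts d = {a}"
    "forces P (upair_fm 12 x y) q (?e d d') \<longleftrightarrow> elts d' = {a, b}"
    "forces P (upair_fm z 11 12) q (?e d d') \<longleftrightarrow> elts c = {d, d'}" if "q \<in> Cond" for q d d'
    using that assms(2-5)
      forces_upair_fm[where p = q and e = "?e d d'" and z = 11 and x = x and y = x and c = d and a = a and b = a]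
      forces_upair_fm[where p = q and e = "?e d d'" and z = 12 and x = x and y = y and c = d' and a = a and b = b]
      forces_upair_fm[where p = q and e = "?e d d'" and z = z and x = 11 and y = 12 and c = c and a = d and b = d']
    by auto
  show ?thesis
  proof
    assume "c = opair a b"
    then have "elts c = {hset_of {a}, hset_of {a, b}}" by (simp add: elts_opair[OF inf])
    then have "forces P (FAnd (upair_fm 11 x x) (FAnd (upair_fm 12 x y) (upair_fm z 11 12))) q
        (?e (hset_of {a}) (hset_of {a, b}))" if "q \<in> Cond" for q
      using up[OF that] by simp
    then show "forces P (opair_fm z x y) p e"
      unfolding opair_fm_def forces.simps(5) using is_name_check le_refl le_Cond by blast
  next
    assume "forces P (opair_fm z x y) p e"
    then obtain r1 \<tau>1 where r1: "r1 \<sqsubseteq> p"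
      "forces P (FEx 12 (FAnd (upair_fm 11 x x) (FAnd (upair_fm 12 x y) (upair_fm z 11 12)))) r1 (e(11 := \<tau>1))"
      using le_refl[OF assms(1)] unfolding opair_fm_def forces.simps(5)[of _ 11] by blast
    moreover have "r1 \<sqsubseteq> r1" using r1(1) le_refl le_Cond by blast
    ultimately obtain r2 \<tau>2 where r2: "r2 \<sqsubseteq> r1"
      "forces P (FAnd (upair_fm 11 x x) (FAnd (upair_fm 12 x y) (upair_fm z 11 12))) r2 (e(11 := \<tau>1, 12 := \<tau>2))"
      unfolding forces.simps(5)[of _ 12] by blast
    have "forces P (FMem 11 z) r2 (e(11 := \<tau>1, 12 := \<tau>2))" "forces P (FMem 12 z) r2 (e(11 := \<tau>1, 12 := \<tau>2))"
      using r2(2) unfolding upair_fm_def[of z] forces.simps(4) by blast+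
    then have mem: "forces_mem P r2 \<tau>1 (check P c)" "forces_mem P r2 \<tau>2 (check P c)"
      using assms(2,5) by auto
    have "r2 \<sqsubseteq> r2" using r2(1) le_refl le_Cond by blast
    then obtain r3 d where r3: "r3 \<sqsubseteq> r2" "forces_eq P r3 \<tau>1 (check P d)"
      using mem(1) unfolding forces_mem_def opair_in_check by blast
    then obtain r4 d' where r4: "r4 \<sqsubseteq> r3" "forces_eq P r4 \<tau>2 (check P d')"
      using mem(2) unfolding forces_mem_def opair_in_check by blast
    have "r4 \<in> Cond" "r4 \<sqsubseteq> r2" using r3 r4 le_trans le_Cond by blast+
    have "forces P (FAnd (upair_fm 11 x x) (FAnd (upair_fm 12 x y) (upair_fm z 11 12))) r4 (?e d d')"
      by (rule forces_subst[OF forces_mono[OF r2(2) \<open>r4 \<sqsubseteq> r2\<close>]])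
        (use r4(2) forces_eq_mono[OF r3(2) r4(1)] in \<open>auto simp: forces_eq_refl\<close>)
    then have "elts d = {a}" "elts d' = {a, b}" "elts c = {d, d'}"
      using up[OF \<open>r4 \<in> Cond\<close>] by simp_all
    moreover have "d = hset_of {a}" "d' = hset_of {a, b}"
      by (simp_all add: \<open>elts d = {a}\<close> \<open>elts d' = {a, b}\<close> flip: elts_inject)
    ultimately have "elts c = elts (opair a b)" by (simp add: elts_opair[OF inf])
    then show "c = opair a b" by (simp add: elts_inject)
  qed
qed

text \<open>Stated for names whose first components are all check names, to cover both
  \<open>check P (hreal g)\<close> and the name of the generic real.\<close>

lemma forces_app_fm:
  assumes "e f = \<tau>" "e x = check P a" "e y = check P b" "is_name P \<tau>"
    and \<tau>: "\<forall>\<rho> t. opair \<rho> t \<in> elts \<tau> \<longrightarrow> (\<exists>c. \<rho> = check P c)"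
    and "{x, y} \<inter> {10, 11, 12, 13} = {}" "f \<noteq> 13"
  shows "forces P (app_fm f x y) p e \<longleftrightarrow>
    (\<forall>q. q \<sqsubseteq> p \<longrightarrow> (\<exists>r t. r \<sqsubseteq> q \<and> r \<sqsubseteq> t \<and> opair (check P (opair a b)) t \<in> elts \<tau>))"
proof -
  have *: "forces P (opair_fm 13 x y) r (e(13 := check P c)) \<longleftrightarrow> c = opair a b" if "r \<in> Cond" for r c
    using that assms by (intro forces_opair_fm) auto
  have app: "opair \<rho> t \<in> elts \<tau> \<and> r \<sqsubseteq> t \<and> forces P (opair_fm 13 x y) r (e(13 := \<rho>)) \<longleftrightarrow>
    opair \<rho> t \<in> elts \<tau> \<and> r \<sqsubseteq> t \<and> \<rho> = check P (opair a b)" for r \<rho> t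
  proof (cases "opair \<rho> t \<in> elts \<tau> \<and> r \<sqsubseteq> t")
    case True
    then obtain c where c: "\<rho> = check P c" using \<tau> by blast
    have "r \<in> Cond" using True le_Cond by blast
    then show ?thesis using *[of r c] check_inject[of r c] c by auto
  qed blast
  have "is_name P (e f)" using assms by simp
  show ?thesis
    unfolding app_fm_def forces_FExIn[of 13 f e, OF assms(7)[symmetric] \<open>is_name P (e f)\<close>]
    unfolding assms(1) app by blast
qed

lemma forces_app_fm_hreal:
  assumes "e f = check P (hreal g)" "e x = check P (hnat k)" "e y = check P (hnat l)"
    "{x, y} \<inter> {10, 11, 12, 13} = {}" "f \<noteq> 13" "p \<in> Cond"
  shows "forces P (app_fm f x y) p e \<longleftrightarrow> l = g k"
proof -
  have *: "opair (check P (opair (hnat k) (hnat l))) t \<in> elts (check P (hreal g)) \<longleftrightarrow> t \<in> Cond \<and> l = g k" for t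
    using check_inject[OF assms(6)] by (auto simp: opair_in_check elts_hreal)
  have \<tau>: "\<forall>\<rho> t. opair \<rho> t \<in> elts (check P (hreal g)) \<longrightarrow> (\<exists>c. \<rho> = check P c)"
    by (auto simp: opair_in_check)
  show ?thesis
    unfolding forces_app_fm[where e = e and f = f and x = x and y = y,
        OF assms(1-3) is_name_check \<tau> assms(4,5)] *
    using assms(6) le_refl le_Cond by blast
qed

section \<open>The generic real named by an unbounded matrix\<close>

definition real_name :: "(nat \<Rightarrow> nat \<Rightarrow> 'k hset set) \<Rightarrow> 'k hset" where
  "real_name a = hset_of (\<Union>(k, n)\<in>UNIV. opair (check P (opair (hnat k) (hnat n))) ` a k n)"

context
  fixes a :: "nat \<Rightarrow> nat \<Rightarrow> 'k hset set"
  assumes mat: "unbounded_matrix a"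
begin

lemma a_down: "p \<in> a k n \<Longrightarrow> q \<sqsubseteq> p \<Longrightarrow> q \<in> a k n"
  and a_Cond: "p \<in> a k n \<Longrightarrow> p \<in> Cond"
  and a_disjoint: "p \<in> a k m \<Longrightarrow> p \<in> a k n \<Longrightarrow> m = n"
  and a_dense: "p \<in> Cond \<Longrightarrow> \<exists>q n. q \<sqsubseteq> p \<and> q \<in> a k n"
  and a_unbounded: "p \<in> Cond \<Longrightarrow> \<exists>k. p \<notin> reg (\<Union>n\<le>g k. a k n)"
  using mat unfolding unbounded_matrix_def down_closed_def by blast+

lemma elts_real_name:
  "elts (real_name a) = (\<Union>(k, n)\<in>UNIV. opair (check P (opair (hnat k) (hnat n))) ` a k n)"
proof -
  have "|UNIV :: (nat \<times> nat) set| \<le>o |UNIV :: nat set|"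
    by (metis card_of_ordLeq inj_prod_encode subset_UNIV)
  also have "|UNIV :: nat set| \<le>o |UNIV :: 'k set|"
    using inf infinite_iff_card_of_nat by blast
  finally show ?thesis
    using elts_UNION[of "UNIV :: (nat \<times> nat) set" "\<lambda>(k, n). a k n"
        "\<lambda>(k, n). opair (check P (opair (hnat k) (hnat n)))"] a_Cond
    by (simp add: real_name_def case_prod_unfold subset_iff)
qed

lemma opair_in_real_name: "opair \<rho> t \<in> elts (real_name a) \<longleftrightarrow>
    (\<exists>k n. \<rho> = check P (opair (hnat k) (hnat n)) \<and> t \<in> a k n)"
  by (auto simp: elts_real_name) blast

lemma is_name_real_name: "is_name P (real_name a)"
  by (rule is_name.intros) (auto simp: elts_real_name is_name_check a_Cond)

text \<open>The name denotes the set of pairs \<open>(k, n)\<close> for which \<open>a k n\<close>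
  meets the generic filter, and \<open>reg (a k n)\<close> consists of the conditions forcing
  this.\<close>

lemma forces_app_fm_real_name:
  assumes "e f = real_name a" "e x = check P (hnat k)" "e y = check P (hnat n)"
    "{x, y} \<inter> {10, 11, 12, 13} = {}" "f \<noteq> 13" "p \<in> Cond"
  shows "forces P (app_fm f x y) p e \<longleftrightarrow> p \<in> reg (a k n)"
proof -
  have *: "opair (check P (opair (hnat k) (hnat n))) t \<in> elts (real_name a) \<longleftrightarrow> t \<in> a k n" for t
    using check_inject[OF assms(6)] by (auto simp: opair_in_real_name)
  have \<tau>: "\<forall>\<rho> t. opair \<rho> t \<in> elts (real_name a) \<longrightarrow> (\<exists>c. \<rho> = check P c)"
    by (auto simp: opair_in_real_name)
  show ?thesis
    unfolding forces_app_fm[where e = e and f = f and x = x and y = y,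
        OF assms(1-3) is_name_real_name \<tau> assms(4,5)] * mem_reg
    using assms(6) a_down a_Cond le_refl by meson
qed

text \<open>Totality comes from density of each row of the matrix, uniqueness of values from
  disjointness within a row.\<close>

lemma forces_real_fm:
  assumes "e 0 = check P hOmega" "e 2 = real_name a" "p \<in> Cond"
  shows "forces P (real_fm 2) p e"
proof -
  have "forces P (FAllIn 14 2 (FExIn 4 0 (FExIn 5 0 (opair_fm 14 4 5)))) p e"
  proof -
    have "forces P (FExIn 4 0 (FExIn 5 0 (opair_fm 14 4 5))) q (e(14 := \<rho>))"
      if \<rho>t: "opair \<rho> t \<in> elts (e 2)" and q: "q \<sqsubseteq> p" for \<rho> t q
    proof -
      obtain k n where \<rho>: "\<rho> = check P (opair (hnat k) (hnat n))"
        using \<rho>t unfolding assms(2) opair_in_real_name by blast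
      have "q \<in> Cond" using q le_Cond by blast
      then have "forces P (opair_fm 14 4 5) q
          (e(14 := \<rho>, 4 := check P (hnat k), 5 := check P (hnat n)))"
        by (subst forces_opair_fm[where c = "opair (hnat k) (hnat n)" and a = "hnat k" and b = "hnat n"])
          (auto simp: \<rho>)
      then show ?thesis
        by (intro forces_FExIn_checkI[where x = hOmega and y = "hnat k"]
            forces_FExIn_checkI[where x = hOmega and y = "hnat n"])
          (auto simp: assms elts_hOmega)
    qed
    then show ?thesis using forces_FAllIn[of 14 2 e] is_name_real_name assms(2) by auto
  qed
  moreover have "forces P (FAllIn 4 0 (FExIn 5 0 (FAnd (app_fm 2 4 5)
      (FAllIn 6 0 (FImp (app_fm 2 4 6) (FEq 6 5)))))) p e"
  proof (subst forces_FAllIn_check[of e 0, OF assms(1) _ assms(3)], simp, rule ballI)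
    fix y :: "'k hset" assume "y \<in> elts hOmega"
    then obtain k where y: "y = hnat k" by (auto simp: elts_hOmega)
    let ?e = "\<lambda>n. e(4 := check P y, 5 := check P (hnat n))"
    have "\<exists>r. r \<sqsubseteq> q \<and> (\<exists>z\<in>elts hOmega. forces P (FAnd (app_fm 2 4 5)
      (FAllIn 6 0 (FImp (app_fm 2 4 6) (FEq 6 5)))) r (e(4 := check P y, 5 := check P z)))"
      if q: "q \<sqsubseteq> p" for q
    proof -
      obtain r n where r: "r \<sqsubseteq> q" "r \<in> a k n" using a_dense q le_Cond by blast
      have rC: "r \<in> Cond" using r le_Cond by blast
      have "r \<in> reg (a k n)" using r(2) a_down le_refl le_Cond rC unfolding mem_reg by blast
      then have "forces P (app_fm 2 4 5) r (?e n)"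
        using rC by (subst forces_app_fm_real_name[of _ _ _ k _ n]) (auto simp: assms y)
      moreover have "forces P (FAllIn 6 0 (FImp (app_fm 2 4 6) (FEq 6 5))) r (?e n)"
      proof (subst forces_FAllIn_check[of _ _ hOmega, OF _ _ rC])
        have "forces P (FEq 6 5) q' ((?e n)(6 := check P (hnat n')))"
          if "q' \<sqsubseteq> r" "forces P (app_fm 2 4 6) q' ((?e n)(6 := check P (hnat n')))" for q' n'
        proof -
          have q': "q' \<in> Cond" using that le_Cond by blast
          then have "q' \<in> reg (a k n')"
            using that(2) by (subst (asm) forces_app_fm_real_name[of _ _ _ k _ n']) (auto simp: assms y)
          then obtain s where "s \<sqsubseteq> q'" "s \<in> a k n'" using q' le_refl unfolding mem_reg by blast
          moreover have "s \<in> a k n" using calculation that(1) r(2) a_down le_trans by blast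
          ultimately have "n' = n" using a_disjoint by blast
          then show ?thesis by (simp add: forces_eq_refl)
        qed
        then show "\<forall>z\<in>elts hOmega. forces P (FImp (app_fm 2 4 6) (FEq 6 5)) r ((?e n)(6 := check P z))"
          by (auto simp: elts_hOmega forces_FImp)
      qed (auto simp: assms)
      ultimately show ?thesis using r(1) by (auto simp: elts_hOmega)
    qed
    then show "forces P (FExIn 5 0 (FAnd (app_fm 2 4 5) (FAllIn 6 0 (FImp (app_fm 2 4 6) (FEq 6 5))))) p
        (e(4 := check P y))"
      by (subst forces_FExIn_check[of _ _ hOmega]) (simp_all add: assms)
  qed
  ultimately show ?thesis unfolding real_fm_def by simp
qed

text \<open>Successive extensions decide finitely many values; this absorbs the exceptions in
  domination modulo finite.\<close>

lemma decide_initial_segment: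
  assumes "q \<in> Cond"
  shows "\<exists>r g. r \<sqsubseteq> q \<and> (\<forall>k<m. r \<in> a k (g k))"
proof (induction m)
  case 0
  show ?case using assms le_refl by auto
next
  case (Suc m)
  then obtain r g where r: "r \<sqsubseteq> q" "\<forall>k<m. r \<in> a k (g k)" by blast
  obtain s n where s: "s \<sqsubseteq> r" "s \<in> a m n" using a_dense r(1) le_Cond by blast
  have "s \<in> a k ((g(m := n)) k)" if "k < Suc m" for k
    using that s r(2) a_down[OF _ s(1)] by (cases "k = m") simp_all
  then show ?case using le_trans[OF s(1) r(1)] by blast
qed

text \<open>If \<open>p\<close> forced domination, an extension would fix the threshold
  \<open>m\<close> and a further one the first \<open>m\<close> values. Below it the real would be
  bounded at every \<open>k\<close>, against \<open>a_unbounded\<close>.\<close>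

lemma not_forces_dominated_fm:
  assumes "e 0 = check P hOmega" "e 2 = real_name a" "e 3 = check P (hreal g)" "p \<in> Cond"
  shows "\<not> forces P (dominated_fm 2 3) p e"
proof
  let ?\<psi> = "FAllIn 6 0 (FAllIn 7 0 (FImp (FAnd (app_fm 2 5 6) (app_fm 3 5 7)) (FOr (FMem 6 7) (FEq 6 7))))"
  let ?\<phi> = "FAllIn 5 0 (FImp (FOr (FMem 4 5) (FEq 4 5)) ?\<psi>)"
  assume "forces P (dominated_fm 2 3) p e"
  then have "forces P (FExIn 4 0 ?\<phi>) p e" by (simp add: dominated_fm_def)
  then obtain q m where q: "q \<sqsubseteq> p" "forces P ?\<phi> q (e(4 := check P (hnat m)))"
    using le_refl[OF assms(4)] by (subst (asm) forces_FExIn_check[of e 0, OF assms(1)]) (auto simp: elts_hOmega)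
  have qC: "q \<in> Cond" using q le_Cond by blast
  \<comment> \<open>Here \<open>r\<close> forces the generic value at \<open>k\<close> to be
    \<open>n\<close>, the ground model value to be \<open>g k\<close>, and domination, so the
    inequality of numerals can be read off.\<close>
  have bound: "n \<le> g k" if "m \<le> k" "r \<sqsubseteq> q" "r \<in> a k n" for k n r
  proof -
    let ?e = "e(4 := check P (hnat m), 5 := check P (hnat k))"
    let ?e' = "?e(6 := check P (hnat n), 7 := check P (hnat (g k)))"
    have "forces P (FImp (FOr (FMem 4 5) (FEq 4 5)) ?\<psi>) q ?e"
      using q(2) by (subst (asm) forces_FAllIn_check[of _ _ hOmega, OF _ _ qC]) (auto simp: assms elts_hOmega)
    moreover have "forces P (FOr (FMem 4 5) (FEq 4 5)) q ?e"
      using that(1) le_Cond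
      by (subst forces_FOr_decided[OF qC, of _ _ "m < k" _ "m = k"])
        (auto simp: forces_mem_check forces_eq_check)
    ultimately have "forces P ?\<psi> q ?e" using qC le_refl by (auto simp: forces_FImp)
    then have "forces P (FAllIn 7 0 (FImp (FAnd (app_fm 2 5 6) (app_fm 3 5 7)) (FOr (FMem 6 7) (FEq 6 7))))
        q (?e(6 := check P (hnat n)))"
      by (subst (asm) forces_FAllIn_check[of _ _ hOmega, OF _ _ qC]) (auto simp: assms elts_hOmega)
    then have "forces P (FImp (FAnd (app_fm 2 5 6) (app_fm 3 5 7)) (FOr (FMem 6 7) (FEq 6 7))) q ?e'"
      by (subst (asm) forces_FAllIn_check[of _ _ hOmega, OF _ _ qC]) (auto simp: assms elts_hOmega)
    moreover have rC: "r \<in> Cond" using that le_Cond by blast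
    moreover have "r \<in> reg (a k n)" using that(3) a_down le_refl le_Cond rC unfolding mem_reg by blast
    then have "forces P (app_fm 2 5 6) r ?e'"
      using rC by (subst forces_app_fm_real_name[of _ _ _ k _ n]) (auto simp: assms)
    moreover have "forces P (app_fm 3 5 7) r ?e'"
      using rC by (subst forces_app_fm_hreal[of _ _ g _ k _ "g k"]) (auto simp: assms)
    ultimately have "forces P (FOr (FMem 6 7) (FEq 6 7)) r ?e'"
      using that(2) by (simp add: forces_FImp)
    then have "n < g k \<or> n = g k"
      by (subst (asm) forces_FOr_decided[OF rC, of _ _ "n < g k" _ "n = g k"])
        (auto simp: forces_mem_check forces_eq_check dest: le_Cond)
    then show ?thesis by auto
  qed
  obtain q' g' where q': "q' \<sqsubseteq> q" "\<And>k. k < m \<Longrightarrow> q' \<in> a k (g' k)"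
    using decide_initial_segment[OF qC, of m] by blast
  have q'C: "q' \<in> Cond" using q' le_Cond by blast
  \<comment> \<open>Below \<open>m\<close> the decided values replace those of \<open>g\<close>, so
    that \<open>G\<close> bounds all values and not only almost all.\<close>
  define G where "G k = (if k < m then g' k else g k)" for k
  have "q' \<in> reg (\<Union>n\<le>G k. a k n)" for k
    unfolding mem_reg
  proof (intro conjI q'C allI impI)
    fix r assume r: "r \<sqsubseteq> q'"
    then obtain s n where s: "s \<sqsubseteq> r" "s \<in> a k n" using a_dense le_Cond by blast
    have sq: "s \<sqsubseteq> q'" using r s le_trans by blast
    have "n \<le> G k"
    proof (cases "k < m")
      case True
      then have "s \<in> a k (g' k)" using q'(2) sq a_down by blast
      then show ?thesis using a_disjoint s(2) True by (auto simp: G_def)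
    next
      case False
      then show ?thesis using bound[OF _ le_trans[OF sq q'(1)] s(2)] by (simp add: G_def)
    qed
    then show "\<exists>r'\<in>(\<Union>n\<le>G k. a k n). r' \<sqsubseteq> r" using s by blast
  qed
  then show False using a_unbounded[OF q'C, of G] by blast
qed

text \<open>The hypothesis on \<open>hBaire\<close> ensures that variable 1 stands for all ground
  model reals; \<open>elts_hBaire\<close> supplies it.\<close>

lemma forces_unbounded_real_fm:
  assumes "p \<in> Cond" "elts (hBaire :: 'k hset) = range hreal"
    "e 0 = check P hOmega" "e 1 = check P hBaire"
  shows "forces P unbounded_real_fm p e"
proof -
  have "forces P (FAnd (real_fm 2) (FAllIn 3 1 (FNeg (dominated_fm 2 3)))) q (e(2 := real_name a))"
    if q: "q \<in> Cond" for q
  proof -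
    have "forces P (FAllIn 3 1 (FNeg (dominated_fm 2 3))) q (e(2 := real_name a))"
    proof (subst forces_FAllIn_check[of _ _ hBaire, OF _ _ q])
      show "\<forall>y\<in>elts hBaire. forces P (FNeg (dominated_fm 2 3)) q (e(2 := real_name a, 3 := check P y))"
      proof
        fix y :: "'k hset" assume "y \<in> elts hBaire"
        then obtain g where "y = hreal g" using assms(2) by auto
        then have "\<not> forces P (dominated_fm 2 3) r (e(2 := real_name a, 3 := check P y))" if "r \<sqsubseteq> q" for r
          using le_Cond(1)[OF that] by (intro not_forces_dominated_fm[of _ g]) (simp_all add: assms(3))
        then show "forces P (FNeg (dominated_fm 2 3)) q (e(2 := real_name a, 3 := check P y))" by simp
      qed
      show "(e(2 := real_name a)) 1 = check P hBaire" using assms(4) by simp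
    qed simp
    moreover have "forces P (real_fm 2) q (e(2 := real_name a))"
      using q by (intro forces_real_fm) (auto simp: assms)
    ultimately show ?thesis by simp
  qed
  then show ?thesis
    unfolding unbounded_real_fm_def forces.simps(5) using is_name_real_name le_refl le_Cond by blast
qed

end

text \<open>An atomless poset with a condition has an infinite completion, so the continuum is at
  most the size of \<open>Pow (RO P)\<close>. This is below \<open>\<theta>\<close>, hence at most
  the size of the index type, and \<open>hset_of\<close> is faithful on the set of all
  reals.\<close>

lemma elts_hBaire:
  assumes "atomless P" "Cond \<noteq> {}" "large_regular \<theta> P"
  shows "elts (hBaire :: 'k hset) = range hreal"
  unfolding hBaire_def
proof (rule elts_hset_of)
  have \<theta>: "Card_order \<theta>" "|Pow (RO P)| <o \<theta>" using assms(3) by (auto simp: large_regular_def)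
  have "|UNIV :: (nat \<Rightarrow> nat) set| \<le>o |UNIV :: nat set set|"
  proof -
    \<comment> \<open>A function is coded by its graph, viewed as a set of naturals.\<close>
    have "inj (\<lambda>g. prod_encode ` range (\<lambda>n. (n, g n :: nat)))"
    proof (rule injI)
      fix x y :: "nat \<Rightarrow> nat"
      assume "prod_encode ` range (\<lambda>n. (n, x n)) = prod_encode ` range (\<lambda>n. (n, y n))"
      then have eq: "range (\<lambda>n. (n, x n)) = range (\<lambda>n. (n, y n))"
        by (simp only: inj_image_eq_iff[OF inj_prod_encode])
      have "(n, x n) \<in> range (\<lambda>n. (n, y n))" for n unfolding eq[symmetric] by blast
      then show "x = y" by auto
    qed
    then show ?thesis by (metis card_of_ordLeq subset_UNIV)
  qed
  moreover have "|UNIV :: nat set set| \<le>o |Pow (RO P)|"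
  proof -
    obtain h :: "nat \<Rightarrow> 'k hset" where h: "inj h" "range h \<subseteq> RO P"
      using infinite_RO[OF assms(1)] assms(2) infinite_countable_subset by blast
    have "inj (image h)" by (rule injI) (simp only: inj_image_eq_iff[OF h(1)])
    moreover have "range (image h) \<subseteq> Pow (RO P)" using h(2) by blast
    ultimately show ?thesis using card_of_ordLeq by blast
  qed
  moreover have "\<theta> \<le>o |UNIV :: 'k set|"
    using \<theta>(1) card_of_Field_ordIso card_of_mono1[OF subset_UNIV]
    by (meson ordIso_ordLeq_trans ordIso_symmetric)
  moreover have "|range (hreal :: _ \<Rightarrow> 'k hset)| \<le>o |UNIV :: (nat \<Rightarrow> nat) set|" by (rule card_of_image)
  ultimately show "|range (hreal :: _ \<Rightarrow> 'k hset)| \<le>o |UNIV :: 'k set|"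
    using \<theta>(2) by (meson ordLeq_transitive ordLess_imp_ordLeq)
qed

end

theorem theorem2p7:
  fixes P :: "'k hset" and \<theta> :: "'k rel"
  assumes "poset P" and "separative P" and "atomless P"
    and "large_regular \<theta> P" and "Ycc \<theta> P"
  shows "adds_unbounded_real P"
proof -
  have \<theta>: "Card_order \<theta>" "natLeq <o \<theta>" "P \<in> Hcard \<theta>"
    using assms(4) by (auto simp: large_regular_def)
  \<comment> \<open>\<open>\<theta>\<close> is a cardinal order on a subset of the index type and
    lies above \<open>natLeq\<close>, so that type is infinite.\<close>
  have "natLeq \<le>o |UNIV :: 'k set|"
    using \<theta>(1,2) card_of_Field_ordIso card_of_mono1[OF subset_UNIV]
    by (meson ordIso_ordLeq_trans ordIso_symmetric ordLeq_transitive ordLess_imp_ordLeq)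
  then have "infinite (UNIV :: 'k set)" using infinite_iff_natLeq_ordLeq by blast
  then interpret forcing_poset P using assms(1) by unfold_locales
  show ?thesis
  proof (cases "pcarrier P = {}")
    case False
    obtain a where "unbounded_matrix a"
      using Ycc_unbounded_matrix[OF assms(2,3,5) \<theta>(3) False] by blast
    then show ?thesis
      unfolding adds_unbounded_real_def
      using forces_unbounded_real_fm elts_hBaire[OF assms(3) False assms(4)] by simp
  \<comment> \<open>For an empty carrier the claim quantifies over no conditions.\<close>
  qed (simp add: adds_unbounded_real_def)
qed

end
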